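(* The set $\{T_0,\dots,T_n,S_1,\dots,S_n\}$ (with $T_m=T_m(z;\mathbf t\,|\,q)$, $S_m=S_m(z;\mathbf t\,|\,q)$) is an orthogonal basis for $V_n$ with respect to the symmetric bilinear form $\langle\cdot,\cdot\rangle_{\rm cher}$. Moreover, $\langle T_m,T_m\rangle_{\rm cher}$ and $\langle S_m,S_m\rangle_{\rm cher}$ are non-zero (for the members $T_m$, $0\le m\le n$, and $S_m$, $1\le m\le n$, of this set).
   Context: Standing assumptions: $0<q<1$; $\mathbf t=(t_1,t_2,t_3,t_4)$ with each $t_i$ real and $|t_i|<1$; $n\ge0$ is an integer. Notation: $(a;q)_k=\prod_{i=0}^{k-1}(1-aq^i)$, $(a;q)_\infty=\prod_{i\ge0}(1-aq^i)$, $(a_1,\dots,a_r;q)_k=\prod_j(a_j;q)_k$, and ${}_4\phi_3(a_1,a_2,a_3,a_4;b_1,b_2,b_3;q,q)=\sum_{k\ge 0}\frac{(a_1,a_2,a_3,a_4;q)_k}{(q,b_1,b_2,b_3;q)_k}q^k$. $V_n$ is the $(2n+1)$-dimensional real vector space of Laurent polynomials spanned by $z^{-n},z^{1-n},\dots,z^{n}$. For $n\ge1$, $S_n(z;\mathbf t\,|\,q)=z(1-t_3/z)(1-t_4/z)\;{}_4\phi_3(q^{1-n},t_1t_2t_3t_4q^{n},t_1z,qt_1/z;\;qt_1t_2,qt_1t_3,qt_1t_4;q,q)$. For $n\ge0$, $T_n(z;\mathbf t\,|\,q)={}_4\phi_3(q^{-n},t_1t_2t_3t_4q^{n-1},t_1z,qt_1/z;\;qt_1t_2,t_1t_3,t_1t_4;q,q)$.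 $w_{\rm cher}(z;\mathbf t\,|\,q)=\dfrac{(q,z^2,qz^{-2};q)_\infty}{\prod_{j=1}^4(t_jz;q)_\infty\,(t_3/z,t_4/z,qt_1/z,qt_2/z;q)_\infty}$ and, for Laurent polynomials $f,g$, $\langle f,g\rangle_{\rm cher}=\frac1{2\pi i}\oint_{|z|=1}f(z)g(z)\,w_{\rm cher}(z;\mathbf t\,|\,q)\,\frac{dz}{z}$. "Orthogonal basis" means a basis whose distinct elements are pairwise orthogonal for this form.
   Formalization: For n ≥ 1 it is additionally assumed that t_1 ≠ 0 and t_3 t_4 ≠ q; otherwise the claim is false, since t_1 = 0 gives T_1 = 0, and t_3 t_4 = q makes T_0, T_1, S_1 all lie in the span of 1 and z + q/z. *)

theory Defs
  imports "HOL-Complex_Analysis.Complex_Analysis" "HOL-Library.Function_Algebras"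
begin

definition qpoch :: "complex \<Rightarrow> complex \<Rightarrow> nat \<Rightarrow> complex" where
  "qpoch a q k = (\<Prod>i<k. 1 - a * q ^ i)"

definition qpoch_inf :: "complex \<Rightarrow> complex \<Rightarrow> complex" where
  "qpoch_inf a q = (\<Prod>i. 1 - a * q ^ i)"

definition qpochs :: "complex list \<Rightarrow> complex \<Rightarrow> nat \<Rightarrow> complex" where
  "qpochs as q k = prod_list (map (\<lambda>a. qpoch a q k) as)"

definition qpochs_inf :: "complex list \<Rightarrow> complex \<Rightarrow> complex" where
  "qpochs_inf as q = prod_list (map (\<lambda>a. qpoch_inf a q) as)"

text \<open>Basic hypergeometric series with one more upper than lower parameter; only used
  with four upper and three lower parameters.\<close>

definition qhyper :: "complex list \<Rightarrow> complex list \<Rightarrow> complex \<Rightarrow> complex \<Rightarrow> complex" where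
  "qhyper as bs q x = (\<Sum>k. qpochs as q k / qpochs (q # bs) q k * x ^ k)"


text \<open>Pointwise real scalar multiplication, so that \<^const>\<open>span\<close> and
  \<^const>\<open>independent\<close> apply to functions (addition is that of Function\_Algebras).\<close>

instantiation "fun" :: (type, real_vector) real_vector
begin

definition scaleR_fun :: "real \<Rightarrow> ('a \<Rightarrow> 'b) \<Rightarrow> 'a \<Rightarrow> 'b" where
  "scaleR_fun c f = (\<lambda>x. c *\<^sub>R f x)"

instance
  by standard (auto simp: scaleR_fun_def fun_eq_iff scaleR_add_right scaleR_add_left)

end

text \<open>Laurent polynomials are regarded as functions on the punctured plane. On the total
  function type they are extended by \<open>0\<close> at the origin: \<open>inverse 0 = 0\<close> would otherwise give
  different formulas for the same Laurent polynomial different values there.\<close>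

definition punctured :: "(complex \<Rightarrow> complex) \<Rightarrow> complex \<Rightarrow> complex" where
  "punctured f = (\<lambda>z. if z = 0 then 0 else f z)"

definition V :: "nat \<Rightarrow> (complex \<Rightarrow> complex) set" where
  "V n = span ((\<lambda>k. punctured (\<lambda>z. z powi k)) ` {- int n..int n})"


text \<open>The parameters \<open>t\<^sub>1, \<dots>, t\<^sub>4\<close> are the values \<open>t 1, \<dots>, t 4\<close> of a function.
  \<open>S n\<close> is meant for \<open>n \<ge> 1\<close> only.\<close>

definition S :: "nat \<Rightarrow> (nat \<Rightarrow> real) \<Rightarrow> real \<Rightarrow> complex \<Rightarrow> complex" where
  "S n t q = punctured (\<lambda>z. z * (1 - t 3 / z) * (1 - t 4 / z) *
     qhyper [q powi (1 - int n), t 1 * t 2 * t 3 * t 4 * q ^ n, t 1 * z, q * t 1 / z]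
            [q * t 1 * t 2, q * t 1 * t 3, q * t 1 * t 4] q q)"

definition T :: "nat \<Rightarrow> (nat \<Rightarrow> real) \<Rightarrow> real \<Rightarrow> complex \<Rightarrow> complex" where
  "T n t q = punctured (\<lambda>z.
     qhyper [q powi (- int n), t 1 * t 2 * t 3 * t 4 * q powi (int n - 1), t 1 * z, q * t 1 / z]
            [q * t 1 * t 2, t 1 * t 3, t 1 * t 4] q q)"

definition w_cher :: "(nat \<Rightarrow> real) \<Rightarrow> real \<Rightarrow> complex \<Rightarrow> complex" where
  "w_cher t q z = qpochs_inf [q, z ^ 2, q * z powi (-2)] q /
     ((\<Prod>j=1..4. qpoch_inf (t j * z) q) *
      qpochs_inf [t 3 / z, t 4 / z, q * t 1 / z, q * t 2 / z] q)"

definition form_cher ::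
  "(nat \<Rightarrow> real) \<Rightarrow> real \<Rightarrow> (complex \<Rightarrow> complex) \<Rightarrow> (complex \<Rightarrow> complex) \<Rightarrow> complex" where
  "form_cher t q f g =
     1 / (2 * pi * \<i>) * contour_integral (circlepath 0 1) (\<lambda>z. f z * g z * w_cher t q z / z)"

definition orthogonal_basis ::
  "('a::real_vector \<Rightarrow> 'a \<Rightarrow> complex) \<Rightarrow> 'a set \<Rightarrow> 'a set \<Rightarrow> bool" where
  "orthogonal_basis form W B \<longleftrightarrow>
     independent B \<and> span B = W \<and> pairwise (\<lambda>f g. form f g = 0) B"

end

theory Submission
  imports Defs
begin

text \<open>
  Two reflections control the weight \<open>w\<close>. With \<open>g(z) = z (1 - t\<^sub>3/z) (1 - t\<^sub>4/z)\<close> the product \<open>g w\<close> is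
  holomorphic on \<open>q \<le> |z| \<le> 1\<close> and antisymmetric under \<open>z \<mapsto> q/z\<close>; with
  \<open>k(z) = (1 - t\<^sub>1 z) (1 - t\<^sub>2 z) / z\<close> the product \<open>k w\<close> is antisymmetric under \<open>z \<mapsto> 1/z\<close> on the
  unit circle. Hence \<open>g u(z + q/z)\<close> and \<open>k u(z + 1/z)\<close> have mean zero for all polynomials \<open>u\<close>. As
  \<open>T\<^sub>m\<close> is a polynomial in \<open>z + q/z\<close> and \<open>S\<^sub>m\<close> is \<open>g\<close> times such a polynomial, the \<open>T\<close>'s are
  orthogonal to the \<open>S\<close>'s.

  The same two facts in low degree show how the means of \<open>1\<close> and of \<open>g\<^sup>2\<close> change under
  \<open>t\<^sub>1 \<mapsto> q t\<^sub>1\<close>. Since \<open>(t\<^sub>1 z, q t\<^sub>1/z; q)\<^sub>k w\<close> is the weight with \<open>t\<^sub>1 q\<^sup>k\<close> in place of \<open>t\<^sub>1\<close>, every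
  moment of degree \<open>j\<close> against it is, up to explicit factors, a polynomial of degree \<open>j\<close> in \<open>q\<^sup>k\<close>,
  and the finite \<open>q\<close>-binomial theorem gives orthogonality within each of the two families. This
  works directly for \<open>t\<^sub>2 = 0\<close>, where the usual dual basis \<open>(t\<^sub>2 z, q t\<^sub>2/z; q)\<^sub>j\<close> degenerates.

  No norm is computed. Decomposing \<open>f \<in> V n\<close> as \<open>u(z + 1/z) + k v(z + 1/z)\<close> splits the form into a
  positive definite and a negative definite part, so it is nondegenerate on \<open>V n\<close>. A spanning
  orthogonal family of nonzero vectors then has nonzero norms and is independent.
\<close>

section \<open>Infinite products and circle means\<close>

lemma qpoch_inf_convergent:
  assumes "norm q < 1"
  shows "convergent_prod (\<lambda>i. 1 - a * q ^ i :: complex)"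
proof (rule abs_convergent_prod_imp_convergent_prod)
  have "summable (\<lambda>i. norm a * norm q ^ i)"
    using assms by (intro summable_mult summable_geometric) simp
  then show "abs_convergent_prod (\<lambda>i. 1 - a * q ^ i)"
    by (simp add: abs_convergent_prod_conv_summable norm_mult norm_power)
qed

lemma qpoch_inf_LIMSEQ:
  assumes "norm q < 1"
  shows "(\<lambda>n. qpoch a q n) \<longlonglongrightarrow> qpoch_inf a q"
  using convergent_prod_LIMSEQ[OF qpoch_inf_convergent[OF assms, of a]]
  by (simp add: qpoch_def qpoch_inf_def LIMSEQ_lessThan_iff_atMost)

lemma qpoch_inf_rec:
  assumes "norm q < 1"
  shows "qpoch_inf a q = (1 - a) * qpoch_inf (a * q) q"
  using has_prod_unique[OF has_prod_ignore_initial_segment'[OF qpoch_inf_convergent[OF assms], of a 1]]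
  by (simp add: qpoch_inf_def mult_ac)

lemma qpoch_inf_nonzero:
  assumes "norm q < 1" "norm a < 1"
  shows "qpoch_inf a q \<noteq> 0"
  unfolding qpoch_inf_def
proof (intro prodinf_nonzero qpoch_inf_convergent assms)
  fix i
  have "norm (a * q ^ i) < 1"
    using assms mult_right_le_one_le[of "norm a" "norm q ^ i"]
    by (simp add: norm_mult norm_power power_le_one)
  then show "1 - a * q ^ i \<noteq> 0"
    by auto
qed

lemma qpoch_inf_cnj:
  assumes "norm q < 1"
  shows "cnj (qpoch_inf a q) = qpoch_inf (cnj a) (cnj q)"
proof -
  have "(\<lambda>n. cnj (qpoch a q n)) \<longlonglongrightarrow> cnj (qpoch_inf a q)"
    by (intro tendsto_cnj qpoch_inf_LIMSEQ assms)
  moreover have "cnj (qpoch a q n) = qpoch (cnj a) (cnj q) n" for n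
    by (simp add: qpoch_def)
  moreover have "(\<lambda>n. qpoch (cnj a) (cnj q) n) \<longlonglongrightarrow> qpoch_inf (cnj a) (cnj q)"
    using assms by (intro qpoch_inf_LIMSEQ) simp
  ultimately show ?thesis
    using LIMSEQ_unique by fastforce
qed

text \<open>On a closed unit ball around \<open>x\<close> the factors differ from 1 by at most
  \<open>(norm x + 1) * norm q ^ n\<close>, so by the M-test the partial products converge uniformly
  there.\<close>

lemma qpoch_inf_holomorphic:
  assumes "norm q < 1"
  shows "(\<lambda>a. qpoch_inf a q) holomorphic_on UNIV"
proof (rule holomorphic_uniform_sequence[of _ "\<lambda>n a. qpoch a q n"])
  show "(\<lambda>a. qpoch a q n) holomorphic_on UNIV" for n
    unfolding qpoch_def by (intro holomorphic_intros)
  fix x :: complex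
  have "uniformly_convergent_on (cball x 1) (\<lambda>n a. \<Prod>i<n. 1 - a * q ^ i)"
  proof (rule uniformly_convergent_on_prod')
    show "uniformly_convergent_on (cball x 1) (\<lambda>N a. \<Sum>n<N. norm (1 - a * q ^ n - 1))"
    proof (rule Weierstrass_m_test'_ev)
      show "\<forall>\<^sub>F n in sequentially. \<forall>a\<in>cball x 1. norm (norm (1 - a * q ^ n - 1)) \<le> (norm x + 1) * norm q ^ n"
      proof (intro always_eventually allI ballI)
        fix n a assume "a \<in> cball x 1"
        then have "norm a \<le> norm x + 1"
          by (metis add.commute add_le_cancel_right dist_norm mem_cball norm_minus_commute norm_triangle_sub order_trans add_left_mono)
        then show "norm (norm (1 - a * q ^ n - 1)) \<le> (norm x + 1) * norm q ^ n"
          by (simp add: norm_mult norm_power mult_right_mono)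
      qed
      show "summable (\<lambda>n. (norm x + 1) * norm q ^ n)"
        using assms by (intro summable_mult summable_geometric) simp
    qed
  qed (auto intro!: continuous_intros)
  then obtain l where l: "uniform_limit (cball x 1) (\<lambda>n a. qpoch a q n) l sequentially"
    by (auto simp: uniformly_convergent_on_def qpoch_def)
  have "l a = qpoch_inf a q" if "a \<in> cball x 1" for a
    using tendsto_uniform_limitI[OF l that] qpoch_inf_LIMSEQ[OF assms, of a] LIMSEQ_unique by blast
  then have "uniform_limit (cball x 1) (\<lambda>n a. qpoch a q n) (\<lambda>a. qpoch_inf a q) sequentially"
    using uniform_limit_cong'[of "cball x 1" "\<lambda>n a. qpoch a q n" "\<lambda>n a. qpoch a q n" l "\<lambda>a. qpoch_inf a q"] l by blast
  then show "\<exists>d>0. cball x d \<subseteq> UNIV \<and> uniform_limit (cball x d) (\<lambda>n a. qpoch a q n) (\<lambda>a. qpoch_inf a q) sequentially"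
    by (intro exI[of _ 1]) simp
qed auto

lemma holomorphic_on_qpoch_inf [holomorphic_intros]:
  assumes "norm q < 1" "f holomorphic_on A"
  shows "(\<lambda>z. qpoch_inf (f z) q) holomorphic_on A"
  using holomorphic_on_compose_gen[OF assms(2) qpoch_inf_holomorphic[OF assms(1)]]
  by (simp add: o_def)

section \<open>Means over the unit circle, inversion and reflection\<close>

definition circle_mean :: "(complex \<Rightarrow> complex) \<Rightarrow> complex" where
  "circle_mean F = 1 / (2 * pi * \<i>) * contour_integral (circlepath 0 1) (\<lambda>z. F z / z)"

lemma contour_integral_circlepath_div:
  assumes "r > 0"
  shows "contour_integral (circlepath 0 r) (\<lambda>z. F z / z) = \<i> * integral {0..2*pi} (\<lambda>x. F (r * cis x))"
proof -
  have "contour_integral (circlepath 0 r) (\<lambda>z. F z / z) = integral {0..2*pi} (\<lambda>x. \<i> * F (r * cis x))"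
    unfolding circlepath_def using assms
    by (subst contour_integral_part_circlepath_eq) (auto intro!: integral_cong)
  then show ?thesis
    by simp
qed

lemma circle_mean_eq_integral:
  fixes F :: "complex \<Rightarrow> complex"
  shows "circle_mean F = 1 / (2 * pi) * integral {0..2*pi} (\<lambda>x. F (cis x))"
  unfolding circle_mean_def using contour_integral_circlepath_div[of 1 F] by simp

lemma circle_mean_cong:
  assumes "\<And>z. norm z = 1 \<Longrightarrow> F z = G z"
  shows "circle_mean F = circle_mean G"
  unfolding circle_mean_eq_integral by (simp add: assms)

lemma integrable_cis:
  assumes "continuous_on (sphere 0 1) (F :: complex \<Rightarrow> 'a::banach)"
  shows "(\<lambda>x. F (cis x)) integrable_on {a..b}"
proof (rule integrable_continuous_real)
  show "continuous_on {a..b} (\<lambda>x. F (cis x))"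
    by (rule continuous_on_compose2[OF assms]) (auto intro!: continuous_intros)
qed

lemma circle_mean_add:
  assumes "continuous_on (sphere 0 1) F" "continuous_on (sphere 0 1) G"
  shows "circle_mean (\<lambda>z. F z + G z) = circle_mean F + circle_mean G"
  unfolding circle_mean_eq_integral
  by (subst integral_add) (simp_all add: assms integrable_cis algebra_simps)

lemma circle_mean_cmult: "circle_mean (\<lambda>z. c * F z) = c * circle_mean F"
  unfolding circle_mean_eq_integral by simp

lemma integral_cis_reflect:
  "integral {0..2*pi} (\<lambda>x. F (cis (-x))) = integral {0..2*pi} (\<lambda>x. F (cis x) :: complex)"
proof -
  have "integral {0..2*pi} (\<lambda>x. F (cis (-x))) = integral {-(2*pi)..0} (\<lambda>x. F (cis x))"
    using Henstock_Kurzweil_Integration.integral_reflect_real[of 0 "-(2*pi)" "\<lambda>x. F (cis x)"] by simp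
  also have "\<dots> = integral {0..2*pi} (\<lambda>x. F (cis (x - 2*pi)))"
    using integral_shift_Icc_real[of 0 "2*pi" "\<lambda>x. F (cis x)" "-2*pi"] by (simp add: o_def algebra_simps)
  also have "(\<lambda>x. cis (x - 2*pi)) = cis"
    by (simp add: fun_eq_iff complex_eq_iff cos_diff sin_diff)
  finally show ?thesis
    by (simp add: fun_eq_iff)
qed

lemma circle_mean_inverse: "circle_mean (\<lambda>z. F (1 / z)) = circle_mean F"
  unfolding circle_mean_eq_integral using integral_cis_reflect[of F]
  by (simp add: cis_inverse[symmetric] inverse_eq_divide)

text \<open>The map z -> r/z carries the unit circle to the circle of radius r. Holomorphy on the
  ring between them moves the contour back, and only a reversal of the angle remains.\<close>

lemma circle_mean_reflect:
  assumes r: "0 < r" "r < 1" and A: "open A" "\<And>z. r \<le> norm z \<Longrightarrow> norm z \<le> 1 \<Longrightarrow> z \<in> A"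
    and F: "F holomorphic_on A"
  shows "circle_mean (\<lambda>z. F (of_real r / z)) = circle_mean F"
proof -
  have "homotopic_loops (A - {0}) (circlepath 0 1) (circlepath 0 r)"
  proof (rule homotopic_loops_linear)
    fix x t assume "t \<in> {0..1::real}"
    define e where "e = exp (2 * of_real pi * \<i> * of_real t)"
    have e: "norm e = 1"
      by (simp add: e_def)
    show "closed_segment (circlepath 0 1 t) (circlepath 0 r t) \<subseteq> A - {0}"
    proof
      fix z assume "z \<in> closed_segment (circlepath 0 1 t) (circlepath 0 r t)"
      then obtain u where u: "0 \<le> u" "u \<le> 1" "z = (1 - u) *\<^sub>R e + u *\<^sub>R (r * e)"
        by (auto simp: closed_segment_def circlepath e_def)
      then have z: "z = of_real ((1 - u) + u * r) * e"
        by (simp add: scaleR_conv_of_real algebra_simps)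
      have "norm z = (1 - u) + u * r"
        using u r unfolding z norm_mult e norm_of_real by simp
      moreover have "(1 - u) + u * r \<ge> r" "(1 - u) + u * r \<le> 1"
        using u r mult_left_le_one_le[of "1 - r" u] mult_left_le[of r u] by (simp_all add: algebra_simps)
      ultimately show "z \<in> A - {0}"
        using A r by auto
    qed
  qed auto
  moreover have "(\<lambda>z. F z / z) holomorphic_on A - {0}"
    using F by (auto intro!: holomorphic_intros intro: holomorphic_on_subset)
  ultimately have "contour_integral (circlepath 0 1) (\<lambda>z. F z / z) = contour_integral (circlepath 0 r) (\<lambda>z. F z / z)"
    using A by (intro Cauchy_theorem_homotopic_loops[of "A - {0}"]) auto
  then have "circle_mean F = 1 / (2 * pi) * integral {0..2*pi} (\<lambda>x. F (r * cis x))"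
    using r by (simp add: circle_mean_def contour_integral_circlepath_div)
  also have "\<dots> = 1 / (2 * pi) * integral {0..2*pi} (\<lambda>x. F (r * cis (-x)))"
    using integral_cis_reflect[of "\<lambda>z. F (r * z)"] by simp
  also have "\<dots> = circle_mean (\<lambda>z. F (of_real r / z))"
    unfolding circle_mean_eq_integral by (simp add: cis_inverse[symmetric] field_simps)
  finally show ?thesis ..
qed

lemma circle_mean_nonneg_eq_0:
  assumes cont: "continuous_on (sphere 0 1) \<rho>" and nonneg: "\<And>z. norm z = 1 \<Longrightarrow> 0 \<le> \<rho> z"
    and zero: "circle_mean (\<lambda>z. of_real (\<rho> z)) = 0" and z: "norm z = 1"
  shows "\<rho> z = 0"
proof -
  have "integral {0..2*pi} (\<lambda>x. complex_of_real (\<rho> (cis x))) = of_real (integral {0..2*pi} (\<lambda>x. \<rho> (cis x)))"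
    using integrable_cis[OF cont] by (intro integral_unique has_integral_of_real integrable_integral)
  then have "integral {0..2*pi} (\<lambda>x. \<rho> (cis x)) = 0"
    using zero by (simp add: circle_mean_eq_integral)
  moreover have "continuous_on {0..2*pi} (\<lambda>x. \<rho> (cis x))"
    by (rule continuous_on_compose2[OF cont]) (auto intro!: continuous_intros)
  ultimately have "\<forall>x\<in>{0..2*pi}. \<rho> (cis x) = 0"
    using nonneg by (subst (asm) integral_eq_0_iff) auto
  moreover have "z = cis (Arg2pi z)" "Arg2pi z \<in> {0..2*pi}"
    using z Arg2pi_eq[of z] Arg2pi_ge_0[of z] Arg2pi_lt_2pi[of z] by (simp_all add: cis_conv_exp)
  ultimately show ?thesis
    by metis
qed

section \<open>Orthogonality from a rational moment recursion\<close>

text \<open>A real copy of \<open>qpoch\<close>: it gives the series real coefficients, as the real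
  span \<open>V n\<close> demands.\<close>

definition qfac :: "real \<Rightarrow> real \<Rightarrow> nat \<Rightarrow> real" where
  "qfac a q k = (\<Prod>i<k. 1 - a * q ^ i)"

lemma qpoch_of_real: "qpoch (of_real a) (of_real q) k = of_real (qfac a q k)"
  by (simp add: qpoch_def qfac_def)

lemma qfac_0 [simp]: "qfac a q 0 = 1"
  by (simp add: qfac_def)

lemma qfac_Suc: "qfac a q (Suc k) = qfac a q k * (1 - a * q ^ k)"
  by (simp add: qfac_def)

lemma qfac_Suc_shift: "qfac a q (Suc k) = (1 - a) * qfac (a * q) q k"
  by (simp add: qfac_def prod.lessThan_Suc_shift mult.assoc del: prod.lessThan_Suc)

lemma qfac_add: "qfac a q (j + k) = qfac a q j * qfac (a * q ^ j) q k"
  by (induction k) (simp_all add: qfac_Suc power_add mult.assoc)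

lemma qfac_nonzero:
  assumes "0 < q" "q < 1" "\<bar>a\<bar> < 1"
  shows "qfac a q k \<noteq> 0"
proof -
  have "a * q ^ i \<noteq> 1" for i
  proof -
    have "\<bar>a * q ^ i\<bar> \<le> \<bar>a\<bar>"
      using assms by (simp add: abs_mult mult_right_le_one_le power_le_one)
    then show ?thesis
      using assms by auto
  qed
  then show ?thesis
    by (auto simp: qfac_def)
qed

lemma qfac_inverse_power_eq_0:
  assumes "q \<noteq> 0" "n < k"
  shows "qfac ((1 / q) ^ n) q k = 0"
  using assms by (auto simp: qfac_def power_one_over intro!: bexI[of _ n])

text \<open>The coefficients obey a Pascal rule, \<open>rec\<close>, whose second term is exactly
  the contribution of the new factor \<open>1 - x * (1/q) ^ Suc n\<close>.\<close>

lemma finite_q_binomial: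
  assumes q: "0 < q" "q < 1"
  shows "(\<Sum>k\<le>n. qfac ((1/q)^n) q k / qfac q q k * x ^ k) = (\<Prod>i<n. 1 - x * (1/q) ^ Suc i)"
proof (induction n)
  case (Suc n)
  define a where "a n k = qfac ((1/q)^n) q k / qfac q q k" for n k
  have rec: "a (Suc n) (Suc k) = a n (Suc k) - (1/q) ^ Suc n * a n k" for k
  proof -
    define u where "u = qfac ((1/q)^n) q k"
    define v where "v = qfac q q k"
    define x where "x = q ^ k"
    define y where "y = (1/q) ^ Suc n"
    have "v \<noteq> 0" "1 - q * x \<noteq> 0"
      using q qfac_nonzero[of q q k] qfac_nonzero[of q q "Suc k"] by (auto simp: v_def x_def qfac_Suc)
    moreover have y: "(1/q) ^ n = y * q"
      using q by (simp add: y_def)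
    moreover have num: "qfac ((1/q) ^ Suc n) q (Suc k) = (1 - y) * u"
      unfolding qfac_Suc_shift by (simp only: y_def[symmetric] u_def y)
    moreover have "a (Suc n) (Suc k) = (1 - y) * u / (v * (1 - q * x))"
      unfolding a_def num by (simp add: qfac_Suc[of q] v_def x_def)
    moreover have "a n (Suc k) = u * (1 - y * q * x) / (v * (1 - q * x))"
      unfolding a_def qfac_Suc u_def v_def x_def y by simp
    moreover have "a n k = u / v"
      by (simp add: a_def u_def v_def)
    moreover have "(1 - y) * u / (v * (1 - q * x)) = u * (1 - y * q * x) / (v * (1 - q * x)) - y * (u / v)"
      using \<open>v \<noteq> 0\<close> \<open>1 - q * x \<noteq> 0\<close> by (simp add: field_simps)
    ultimately show ?thesis
      by (simp only: y_def)
  qed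
  have "(\<Sum>k\<le>Suc n. a (Suc n) k * x ^ k)
      = a (Suc n) 0 + (\<Sum>k\<le>n. a n (Suc k) * x ^ Suc k) - (1/q) ^ Suc n * x * (\<Sum>k\<le>n. a n k * x ^ k)"
    unfolding sum.atMost_Suc_shift
    by (simp add: rec ring_distribs sum_subtractf sum_distrib_left mult_ac)
  also have "a (Suc n) 0 + (\<Sum>k\<le>n. a n (Suc k) * x ^ Suc k) = (\<Sum>k\<le>Suc n. a n k * x ^ k)"
    unfolding sum.atMost_Suc_shift by (simp add: a_def)
  also have "\<dots> = (\<Sum>k\<le>n. a n k * x ^ k)"
    using q by (simp add: a_def qfac_inverse_power_eq_0)
  finally show ?case
    using Suc by (simp add: a_def algebra_simps)
qed simp

text \<open>By linearity a power with exponent i < n is enough. Then the sum is the q-binomial sum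
  at \<open>q ^ Suc i\<close>, and the factor with index i of its product form vanishes.\<close>

lemma q_binomial_poly_sum_eq_0:
  fixes P :: "real poly"
  assumes q: "0 < q" "q < 1" and "degree P < n"
  shows "(\<Sum>k\<le>n. qfac ((1/q)^n) q k / qfac q q k * q ^ k * poly P (q ^ k)) = 0"
proof -
  have *: "(\<Sum>k\<le>n. qfac ((1/q)^n) q k / qfac q q k * q ^ k * (q ^ k) ^ i) = 0" if "i < n" for i
  proof -
    have "(\<Sum>k\<le>n. qfac ((1/q)^n) q k / qfac q q k * q ^ k * (q ^ k) ^ i)
        = (\<Sum>k\<le>n. qfac ((1/q)^n) q k / qfac q q k * (q ^ Suc i) ^ k)"
      by (simp add: power_mult[symmetric] mult.commute power_mult_distrib mult.left_commute)
    also have "\<dots> = 0"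
      unfolding finite_q_binomial[OF q] using that q by (auto simp: power_one_over intro!: bexI[of _ i])
    finally show ?thesis .
  qed
  have "(\<Sum>k\<le>n. qfac ((1/q)^n) q k / qfac q q k * q ^ k * poly P (q ^ k))
      = (\<Sum>i\<le>degree P. coeff P i * (\<Sum>k\<le>n. qfac ((1/q)^n) q k / qfac q q k * q ^ k * (q ^ k) ^ i))"
    unfolding poly_altdef sum_distrib_left by (subst sum.swap) (simp add: mult_ac)
  also have "\<dots> = 0"
  proof (intro sum.neutral ballI)
    fix i assume "i \<in> {..degree P}"
    with assms(3) have "i < n"
      by simp
    show "coeff P i * (\<Sum>k\<le>n. qfac ((1/q)^n) q k / qfac q q k * q ^ k * (q ^ k) ^ i) = 0"
      unfolding *[OF \<open>i < n\<close>] by simp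
  qed
  finally show ?thesis .
qed

section \<open>Askey-Wilson polynomials and functionals with a shift\<close>

definition aw_factor :: "real \<Rightarrow> real \<Rightarrow> real \<Rightarrow> nat \<Rightarrow> real poly" where
  "aw_factor a b q k = [:1 + b * (q ^ k)\<^sup>2, - (a * q ^ k):]"

text \<open>For b = q a^2 and the variable z + q/z, factor i is (1 - a q^i z)(1 - q a q^i / z), so
  the product is (a z, q a/z; q)_k.\<close>

definition aw_basis :: "real \<Rightarrow> real \<Rightarrow> real \<Rightarrow> nat \<Rightarrow> real poly" where
  "aw_basis a b q k = (\<Prod>i<k. aw_factor a b q i)"

text \<open>The coefficient of a terminating 4phi3 without its two z-dependent factorials:
  \<open>d\<close> is the second upper parameter, \<open>\<alpha>, \<beta>, \<gamma>\<close> are the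
  lower ones.\<close>

definition aw_coeff :: "real \<Rightarrow> real \<Rightarrow> real \<Rightarrow> real \<Rightarrow> real \<Rightarrow> nat \<Rightarrow> nat \<Rightarrow> real" where
  "aw_coeff q d \<alpha> \<beta> \<gamma> n k =
     qfac ((1/q)^n) q k * qfac d q k * q ^ k / (qfac q q k * qfac \<alpha> q k * qfac \<beta> q k * qfac \<gamma> q k)"

definition aw_poly where
  "aw_poly a b q d \<alpha> \<beta> \<gamma> n = (\<Sum>k\<le>n. smult (aw_coeff q d \<alpha> \<beta> \<gamma> n k) (aw_basis a b q k))"

text \<open>\<open>L k p\<close> stands for the mean of \<open>p(z + q/z)\<close> against the weight with parameter \<open>t\<^sub>1 q\<^sup>k\<close>; passing from
  \<open>k\<close> to \<open>k + 1\<close> multiplies the weight by the factor \<open>(1 - t\<^sub>1 q\<^sup>k z) (1 - q t\<^sub>1 q\<^sup>k / z)\<close>. In the usual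
  notation for Askey-Wilson polynomials with parameters \<open>A, B, C, D\<close>, \<open>\<alpha>, \<beta>, \<gamma>, e\<close> are \<open>A B, A C, A D, A B C D\<close>
  and \<open>b = A\<^sup>2\<close>.\<close>

locale aw_moments =
  fixes L :: "nat \<Rightarrow> real poly \<Rightarrow> complex" and a b q e \<alpha> \<beta> \<gamma> :: real
  assumes add: "L k (p + r) = L k p + L k r"
    and smult: "L k (smult c p) = of_real c * L k p"
    and shift: "L (Suc k) p = L k (aw_factor a b q k * p)"
    and mass: "L (Suc k) 1 * of_real (1 - e * q ^ k) =
                 L k 1 * of_real ((1 - \<alpha> * q ^ k) * (1 - \<beta> * q ^ k) * (1 - \<gamma> * q ^ k))"
    and balance: "\<alpha> * \<beta> * \<gamma> = b * e"
    and a: "a \<noteq> 0" and q: "0 < q" "q < 1"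
    and small: "\<bar>e\<bar> < 1" "\<bar>\<alpha>\<bar> < 1" "\<bar>\<beta>\<bar> < 1" "\<bar>\<gamma>\<bar> < 1"
begin

text \<open>This is \<open>shift\<close> solved for multiplication by the variable: raising the
  degree by one costs a passage from k to k + 1.\<close>

lemma shift_pCons:
  "of_real (a * q ^ k) * L k (pCons 0 p) = of_real (1 + b * (q ^ k)\<^sup>2) * L k p - L (Suc k) p"
proof -
  have "aw_factor a b q k * p = smult (1 + b * (q ^ k)\<^sup>2) p + smult (- (a * q ^ k)) (pCons 0 p)"
    by (simp add: aw_factor_def)
  then have "L (Suc k) p = of_real (1 + b * (q ^ k)\<^sup>2) * L k p + of_real (- (a * q ^ k)) * L k (pCons 0 p)"
    by (simp only: shift add smult)
  then show ?thesis
    by simp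
qed

text \<open>The numerator \<open>N\<close> below has degree at most \<open>j + 2\<close> rather than \<open>j + 3\<close> because its top coefficient
  cancels by the relation \<open>\<alpha> \<beta> \<gamma> = b e\<close>, and it is divisible by the variable.\<close>

lemma moment_rational:
  assumes "degree p \<le> j"
  shows "\<exists>P. degree P \<le> j \<and>
           (\<forall>k. L k p * of_real (qfac (e * q ^ k) q j) = L k 1 * of_real (poly P (q ^ k)))"
  using assms
proof (induction j arbitrary: p)
  case 0
  then obtain c where "p = smult c 1"
    by (metis degree_0_id le_zero_eq of_nat_1 one_pCons smult_1_left smult_pCons mult_1_right smult_0_right degree_eq_zeroE)
  then show ?case
    by (intro exI[of _ "[:c:]"]) (simp only: smult, simp)
next
  case (Suc j)
  obtain c p' where p: "p = pCons c p'"
    by (cases p)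
  with Suc.prems have "degree p' \<le> j"
    by (auto split: if_splits)
  from Suc.IH[OF this] obtain P where P: "degree P \<le> j"
    "\<And>k. L k p' * of_real (qfac (e * q ^ k) q j) = L k 1 * of_real (poly P (q ^ k))"
    by blast
  \<comment> \<open>\<open>Q\<close> is \<open>P\<close> at q x: for x = q^k this is the value
    belonging to index k + 1.\<close>
  define Q where "Q = pcompose P [:0, q:]"
  define N where "N = [:1, 0, b:] * [:1, - (e * q ^ j):] * P - [:1, -\<alpha>:] * [:1, -\<beta>:] * [:1, -\<gamma>:] * Q"
  obtain n0 N' where N': "N = pCons n0 N'"
    by (cases N)
  have "poly N 0 = 0"
    by (simp add: N_def Q_def poly_pcompose)
  then have n0: "n0 = 0"
    by (simp add: N')
  have deg: "degree N' \<le> Suc j"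
  proof (rule degree_le, intro allI impI)
    fix i assume i: "Suc j < i"
    then obtain i' where i': "i = Suc (Suc i')" "j \<le> i'"
      by (metis Suc_less_eq2 less_Suc_eq_le Suc_lessE Suc_leI less_imp_Suc_add add_Suc le_add1)
    have cP: "coeff P m = 0" if "m > j" for m
      using P(1) that by (intro coeff_eq_0) simp
    have cQ: "coeff Q m = q ^ m * coeff P m" for m
      unfolding Q_def by (simp add: coeff_pcompose_linear)
    have "coeff N (Suc i) = (\<alpha> * \<beta> * \<gamma> - b * e) * q ^ j * coeff P i'"
      using i'(2) unfolding N_def i'(1) by (cases "i' = j") (auto simp: cP cQ algebra_simps)
    then show "coeff N' i = 0"
      by (simp add: N' balance)
  qed
  \<comment> \<open>The denominator (e x; q)_(j+1) as a polynomial in x; it absorbs the constant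
    term \<open>c\<close> of \<open>p\<close>.\<close>
  define B where "B = (\<Prod>i<Suc j. [:1, - (e * q ^ i):])"
  have B: "poly B x = qfac (e * x) q (Suc j)" for x
    unfolding B_def poly_prod qfac_def by (simp add: mult_ac)
  have degB: "degree B \<le> Suc j"
  proof -
    have "degree B \<le> (\<Sum>i<Suc j. degree [:1, - (e * q ^ i):])"
      unfolding B_def using degree_prod_sum_le[of "{..<Suc j}" "\<lambda>i. [:1, - (e * q ^ i):]"] by (simp add: o_def)
    also have "\<dots> \<le> (\<Sum>i<Suc j. 1)"
      by (intro sum_mono) (auto simp: degree_pCons_le)
    finally show ?thesis by simp
  qed
  show ?case
  proof (intro exI[of _ "smult c B + smult (1/a) N'"] conjI allI)
    show "degree (smult c B + smult (1/a) N') \<le> Suc j"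
      by (intro degree_add_le order.trans[OF degree_smult_le] degB deg)
    fix k
    define x where "x = q ^ k"
    have x: "x \<noteq> 0"
      using q by (simp add: x_def)
    have Nx: "poly N x = x * poly N' x"
      by (simp add: N' n0)
    define F where "F = complex_of_real (qfac (e * x) q (Suc j))"
    \<comment> \<open>Splitting off the last factor fits the induction hypothesis at k, splitting
      off the first one fits it at k + 1.\<close>
    have F1: "F = of_real (1 - e * x * q ^ j) * of_real (qfac (e * x) q j)"
      by (simp add: F_def qfac_Suc)
    have F2: "F = of_real (1 - e * x) * of_real (qfac (e * q ^ Suc k) q j)"
      by (simp add: F_def qfac_Suc_shift x_def mult_ac)
    have "of_real (a * x) * L k (pCons 0 p') * F
        = (of_real (1 + b * x\<^sup>2) * L k p' - L (Suc k) p') * F"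
      unfolding x_def shift_pCons ..
    also have "\<dots> = of_real (1 + b * x\<^sup>2) * (L k p' * F) - L (Suc k) p' * F"
      by (simp add: algebra_simps)
    also have "L k p' * F = L k 1 * of_real ((1 - e * x * q ^ j) * poly P x)"
      unfolding F1 using P(2)[of k] by (simp add: x_def)
    also have "L (Suc k) p' * F = of_real (1 - e * x) * (L (Suc k) 1 * of_real (poly P (x * q)))"
      unfolding F2 using P(2)[of "Suc k"] by (simp add: x_def mult_ac)
    also have "\<dots> = L k 1 * of_real ((1 - \<alpha> * x) * (1 - \<beta> * x) * (1 - \<gamma> * x) * poly P (x * q))"
      using mass[of k] by (simp add: x_def mult_ac)
    also have "of_real (1 + b * x\<^sup>2) * (L k 1 * of_real ((1 - e * x * q ^ j) * poly P x)) -
        L k 1 * of_real ((1 - \<alpha> * x) * (1 - \<beta> * x) * (1 - \<gamma> * x) * poly P (x * q)) = L k 1 * of_real (poly N x)"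
      unfolding N_def Q_def by (simp add: poly_pcompose algebra_simps power2_eq_square)
    finally have *: "L k (pCons 0 p') * F = L k 1 * of_real (poly N' x / a)"
      using x a by (simp add: Nx field_simps)
    have "p = smult c 1 + pCons 0 p'"
      by (simp add: p)
    then have "L k p = of_real c * L k 1 + L k (pCons 0 p')"
      by (simp only: add smult)
    then have "L k p * F = L k 1 * (of_real c * F) + L k 1 * of_real (poly N' x / a)"
      using * by (simp add: algebra_simps)
    also have "\<dots> = L k 1 * of_real (poly (smult c B + smult (1/a) N') x)"
      by (simp add: F_def B algebra_simps)
    finally show "L k p * of_real (qfac (e * q ^ k) q (Suc j)) =
        L k 1 * of_real (poly (smult c B + smult (1/a) N') (q ^ k))"
      by (simp add: F_def x_def)
  qed
qed

lemma mass_eq: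
  "L k 1 * of_real (qfac e q k) = L 0 1 * of_real (qfac \<alpha> q k * qfac \<beta> q k * qfac \<gamma> q k)"
proof (induction k)
  case (Suc k)
  have "L (Suc k) 1 * of_real (qfac e q (Suc k)) = (L (Suc k) 1 * of_real (1 - e * q ^ k)) * of_real (qfac e q k)"
    by (simp add: qfac_Suc)
  also have "\<dots> = (L k 1 * of_real (qfac e q k)) * of_real ((1 - \<alpha> * q ^ k) * (1 - \<beta> * q ^ k) * (1 - \<gamma> * q ^ k))"
    unfolding mass by simp
  finally show ?case
    unfolding Suc by (simp add: qfac_Suc mult_ac)
qed simp

lemma shift_basis: "L 0 (aw_basis a b q k * p) = L k p"
proof (induction k arbitrary: p)
  case (Suc k)
  show ?case
    using Suc[of "aw_factor a b q k * p"] by (simp add: aw_basis_def shift mult.assoc)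
qed (simp add: aw_basis_def)

lemma zero: "L k 0 = 0"
  using smult[of k 0 0] by simp

lemma sum: "L k (\<Sum>i\<in>A. f i) = (\<Sum>i\<in>A. L k (f i))"
  by (induction A rule: infinite_finite_induct) (simp_all add: add zero)

text \<open>By \<open>shift_basis\<close> each term becomes \<open>L k r\<close>, which is L 0 1
  times a polynomial in q^k of degree below n times (\<alpha>, \<beta>, \<gamma>; q)_k / ((e; q)_k
  (e q^k; q)_(n-1)). The coefficients of \<open>aw_poly\<close> cancel this quotient up to a
  constant, and a vanishing q-binomial sum remains.\<close>

theorem aw_poly_orthogonal:
  assumes d: "d * q = e * q ^ n" and r: "degree r < n"
  shows "L 0 (aw_poly a b q d \<alpha> \<beta> \<gamma> n * r) = 0"
proof -
  obtain m where n: "n = Suc m"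
    using r by (cases n) auto
  have d': "d = e * q ^ m"
    using d q by (simp add: n)
  obtain P where P: "degree P \<le> m"
    "\<And>k. L k r * of_real (qfac (e * q ^ k) q m) = L k 1 * of_real (poly P (q ^ k))"
    using moment_rational[of r m] r n by auto
  have nz: "qfac e q k \<noteq> 0" "qfac \<alpha> q k \<noteq> 0" "qfac \<beta> q k \<noteq> 0" "qfac \<gamma> q k \<noteq> 0" for k
    using qfac_nonzero q small by auto
  have term_eq: "of_real (aw_coeff q d \<alpha> \<beta> \<gamma> n k) * L k r =
      L 0 1 / of_real (qfac e q m) * of_real (qfac ((1/q)^n) q k / qfac q q k * q ^ k * poly P (q ^ k))" for k
  proof -
    \<comment> \<open>Both sides are (e; q)_(k+m), split after k and after m factors.\<close>
    have s: "qfac e q k * qfac (e * q ^ k) q m = qfac e q m * qfac d q k"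
      using qfac_add[of e q k m] qfac_add[of e q m k] by (simp add: d' add.commute)
    have "L k r * of_real (qfac e q m * qfac d q k) = of_real (qfac e q k) * (L k r * of_real (qfac (e * q ^ k) q m))"
      unfolding s[symmetric] by simp
    also have "\<dots> = (L k 1 * of_real (qfac e q k)) * of_real (poly P (q ^ k))"
      unfolding P(2) by simp
    also have "\<dots> = L 0 1 * of_real (qfac \<alpha> q k * qfac \<beta> q k * qfac \<gamma> q k * poly P (q ^ k))"
      unfolding mass_eq by simp
    finally have *: "L k r * of_real (qfac e q m) * of_real (qfac d q k) =
        L 0 1 * of_real (qfac \<alpha> q k * qfac \<beta> q k * qfac \<gamma> q k * poly P (q ^ k))"
      by (simp add: mult_ac)
    define C where "C = qfac \<alpha> q k * qfac \<beta> q k * qfac \<gamma> q k"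
    have "of_real (qfac d q k) * L k r = L 0 1 / of_real (qfac e q m) * of_real (C * poly P (q ^ k))"
      using * nz(1)[of m] by (simp add: field_simps C_def)
    moreover have "of_real (aw_coeff q d \<alpha> \<beta> \<gamma> n k) * L k r =
        of_real (qfac ((1/q)^n) q k / qfac q q k * q ^ k / C) * (of_real (qfac d q k) * L k r)"
      by (simp add: aw_coeff_def C_def mult_ac)
    moreover have "C \<noteq> 0"
      using nz by (simp add: C_def)
    ultimately show ?thesis
      by (simp add: mult_ac)
  qed
  have "L 0 (aw_poly a b q d \<alpha> \<beta> \<gamma> n * r) = (\<Sum>k\<le>n. of_real (aw_coeff q d \<alpha> \<beta> \<gamma> n k) * L k r)"
    by (simp add: aw_poly_def sum_distrib_right sum smult shift_basis)
  also have "\<dots> = L 0 1 / of_real (qfac e q m) *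
      of_real (\<Sum>k\<le>n. qfac ((1/q)^n) q k / qfac q q k * q ^ k * poly P (q ^ k))"
    unfolding term_eq by (simp add: sum_distrib_left)
  also have "\<dots> = 0"
    using q_binomial_poly_sum_eq_0[OF q, of P n] P(1) n by (simp del: of_real_sum)
  finally show ?thesis .
qed

end

section \<open>Laurent polynomials and the two reflections\<close>

definition cpoly :: "real poly \<Rightarrow> complex \<Rightarrow> complex" where
  "cpoly p z = poly (map_poly of_real p) z"

lemma cpoly_simps [simp]:
  "cpoly 0 z = 0" "cpoly 1 z = 1" "cpoly (pCons c p) z = of_real c + z * cpoly p z"
  by (simp_all add: cpoly_def map_poly_pCons)

lemma cpoly_add [simp]: "cpoly (p + r) z = cpoly p z + cpoly r z"
proof -
  have "map_poly complex_of_real (p + r) = map_poly of_real p + map_poly of_real r"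
    by (rule poly_eqI) (simp add: coeff_map_poly)
  then show ?thesis
    by (simp add: cpoly_def)
qed

lemma cpoly_smult [simp]: "cpoly (smult c p) z = of_real c * cpoly p z"
proof -
  have "map_poly complex_of_real (smult c p) = smult (of_real c) (map_poly of_real p)"
    by (rule poly_eqI) (simp add: coeff_map_poly)
  then show ?thesis
    by (simp add: cpoly_def)
qed

lemma cpoly_mult [simp]: "cpoly (p * r) z = cpoly p z * cpoly r z"
  by (induction p) (simp_all add: algebra_simps)

lemma cpoly_minus [simp]: "cpoly (- p) z = - cpoly p z"
  using cpoly_smult[of "-1" p z] by simp

lemma cpoly_diff [simp]: "cpoly (p - r) z = cpoly p z - cpoly r z"
  using cpoly_add[of p "- r" z] by simp

lemma cpoly_sum [simp]: "cpoly (\<Sum>i\<in>A. f i) z = (\<Sum>i\<in>A. cpoly (f i) z)"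
  by (induction A rule: infinite_finite_induct) simp_all

lemma cpoly_prod [simp]: "cpoly (\<Prod>i\<in>A. f i) z = (\<Prod>i\<in>A. cpoly (f i) z)"
  by (induction A rule: infinite_finite_induct) simp_all

lemma cpoly_of_real: "cpoly p (of_real x) = of_real (poly p x)"
  by (induction p) simp_all

lemma cpoly_holomorphic [holomorphic_intros]: "f holomorphic_on A \<Longrightarrow> (\<lambda>z. cpoly p (f z)) holomorphic_on A"
  unfolding cpoly_def by (intro holomorphic_intros)

lemma cpoly_continuous [continuous_intros]: "continuous_on A f \<Longrightarrow> continuous_on A (\<lambda>z. cpoly p (f z))"
  unfolding cpoly_def by (intro continuous_intros)

text \<open>For s nonzero, Laurent polynomials are a free module with basis 1, z over the
  polynomials in z + s/z, the invariants of z -> s/z. Both s = q and s = 1 are used.\<close>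

definition laurent :: "real \<Rightarrow> real poly \<Rightarrow> real poly \<Rightarrow> complex \<Rightarrow> complex" where
  "laurent s p r = punctured (\<lambda>z. cpoly p (z + s / z) + z * cpoly r (z + s / z))"

text \<open>In contrast to \<open>degree p < n\<close>, this makes \<open>deg_less p 0\<close> equivalent to \<open>p = 0\<close>.\<close>

definition deg_less :: "real poly \<Rightarrow> nat \<Rightarrow> bool" where
  "deg_less p n \<longleftrightarrow> (\<forall>i\<ge>n. coeff p i = 0)"

lemma deg_less_0 [simp]: "deg_less 0 n"
  by (simp add: deg_less_def)

lemma deg_less_0_iff [simp]: "deg_less p 0 \<longleftrightarrow> p = 0"
  by (auto simp: deg_less_def poly_eq_iff)

lemma deg_less_Suc_iff: "deg_less p (Suc n) \<longleftrightarrow> degree p \<le> n"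
  by (auto simp: deg_less_def degree_le coeff_eq_0)

lemma deg_less_add: "deg_less p n \<Longrightarrow> deg_less r n \<Longrightarrow> deg_less (p + r) n"
  by (simp add: deg_less_def)

lemma deg_less_smult: "deg_less p n \<Longrightarrow> deg_less (smult c p) n"
  by (simp add: deg_less_def)

lemma deg_less_mono: "deg_less p n \<Longrightarrow> n \<le> m \<Longrightarrow> deg_less p m"
  by (simp add: deg_less_def)

lemma deg_less_pCons: "deg_less p n \<Longrightarrow> deg_less (pCons c p) (Suc n)"
  by (auto simp: deg_less_def coeff_pCons split: nat.splits)

lemma laurent_add: "laurent s (p + p') (r + r') = laurent s p r + laurent s p' r'"
  by (auto simp: laurent_def punctured_def fun_eq_iff algebra_simps)

lemma laurent_scale: "laurent s (smult c p) (smult c r) = c *\<^sub>R laurent s p r"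
  by (auto simp: laurent_def punctured_def fun_eq_iff scaleR_fun_def scaleR_conv_of_real algebra_simps)

lemma laurent_0 [simp]: "laurent s 0 0 = 0"
  by (auto simp: laurent_def punctured_def fun_eq_iff)

definition lpow :: "int \<Rightarrow> complex \<Rightarrow> complex" where
  "lpow k = punctured (\<lambda>z. z powi k)"

lemma V_altdef: "V n = span (lpow ` {- int n..int n})"
  by (simp add: V_def lpow_def)

lemma lpow_laurent_nat:
  "\<exists>p r. deg_less p (Suc n) \<and> deg_less r n \<and> lpow (int n) = laurent s p r"
proof (induction n)
  case 0
  then show ?case
    by (intro exI[of _ 1] exI[of _ 0]) (auto simp: lpow_def laurent_def deg_less_Suc_iff fun_eq_iff punctured_def)
next
  case (Suc n)
  then obtain p r where pr: "deg_less p (Suc n)" "deg_less r n" "lpow (int n) = laurent s p r"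
    by blast
  \<comment> \<open>With X = z + s/z one has z^2 = z X - s, hence z (p + z r) = - s r + z (p + X
    r).\<close>
  have "lpow (int (Suc n)) = laurent s (smult (- s) r) (p + pCons 0 r)"
  proof
    fix z :: complex
    show "lpow (int (Suc n)) z = laurent s (smult (- s) r) (p + pCons 0 r) z"
    proof (cases "z = 0")
      case False
      define X where "X = z + s / z"
      have X: "z * X = z * z + s"
        using False by (simp add: X_def field_simps)
      have "z ^ n = cpoly p X + z * cpoly r X"
        using fun_cong[OF pr(3), of z] False by (simp add: lpow_def laurent_def punctured_def X_def)
      then have "z ^ Suc n = z * cpoly p X + (z * X - s) * cpoly r X"
        unfolding X by (simp add: algebra_simps)
      also have "\<dots> = of_real (- s) * cpoly r X + z * (cpoly p X + X * cpoly r X)"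
        by (simp add: algebra_simps)
      finally show ?thesis
        using False by (simp add: lpow_def laurent_def punctured_def X_def[symmetric] del: of_nat_Suc)
    qed (simp add: lpow_def laurent_def punctured_def)
  qed
  moreover have "deg_less (smult (- s) r) (Suc (Suc n))"
    using pr by (intro deg_less_smult) (auto elim: deg_less_mono)
  moreover have "deg_less (p + pCons 0 r) (Suc n)"
    using pr by (intro deg_less_add deg_less_pCons)
  ultimately show ?case
    by blast
qed

lemma lpow_laurent_neg:
  assumes s: "s \<noteq> 0"
  shows "\<exists>p r. deg_less p (Suc n) \<and> deg_less r n \<and> lpow (- int n) = laurent s p r"
proof (induction n)
  case 0
  then show ?case
    by (intro exI[of _ 1] exI[of _ 0]) (auto simp: lpow_def laurent_def deg_less_Suc_iff fun_eq_iff punctured_def)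
next
  case (Suc n)
  then obtain p r where pr: "deg_less p (Suc n)" "deg_less r n" "lpow (- int n) = laurent s p r"
    by blast
  \<comment> \<open>Here 1/z = (X - z)/s, hence (p + z r)/z = X p/s + r - z p/s.\<close>
  have "lpow (- int (Suc n)) = laurent s (smult (1/s) (pCons 0 p) + r) (smult (-1/s) p)"
  proof
    fix z :: complex
    show "lpow (- int (Suc n)) z = laurent s (smult (1/s) (pCons 0 p) + r) (smult (-1/s) p) z"
    proof (cases "z = 0")
      case False
      define X where "X = z + s / z"
      have X: "1 / z = (X - z) / s"
        using False s by (simp add: X_def field_simps)
      have "z powi (- int n) = cpoly p X + z * cpoly r X"
        using fun_cong[OF pr(3), of z] False by (simp add: lpow_def laurent_def punctured_def X_def)
      moreover have "z powi (- int (Suc n)) = z powi (- int n) * (1 / z)"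
        using False power_int_add[of z "- int n" "-1"] by (simp add: field_simps)
      ultimately have "z powi (- int (Suc n)) = cpoly p X * (1 / z) + cpoly r X"
        using False by (simp add: field_simps)
      also have "\<dots> = of_real (1/s) * (X * cpoly p X) + cpoly r X + z * (of_real (-1/s) * cpoly p X)"
        unfolding X by (simp add: diff_divide_distrib algebra_simps)
      finally show ?thesis
        using False by (simp add: lpow_def laurent_def punctured_def X_def[symmetric] del: of_nat_Suc)
    qed (simp add: lpow_def laurent_def punctured_def)
  qed
  moreover have "deg_less (smult (1/s) (pCons 0 p) + r) (Suc (Suc n))"
    using pr by (intro deg_less_smult deg_less_add deg_less_pCons) (auto elim: deg_less_mono)
  moreover have "deg_less (smult (-1/s) p) (Suc n)"
    using pr by (intro deg_less_smult)
  ultimately show ?case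
    by blast
qed

lemma V_laurent:
  assumes s: "s \<noteq> 0" and f: "f \<in> V n"
  shows "\<exists>p r. deg_less p (Suc n) \<and> deg_less r n \<and> f = laurent s p r"
  using f unfolding V_altdef
proof (induction rule: span_induct_alt)
  case base
  then show ?case
    by (intro exI[of _ 0]) simp
next
  case (step c x y)
  then obtain k where k: "k \<in> {- int n..int n}" "x = lpow k"
    by auto
  obtain p r where pr: "deg_less p (Suc (nat \<bar>k\<bar>))" "deg_less r (nat \<bar>k\<bar>)" "x = laurent s p r"
    using lpow_laurent_nat[of "nat \<bar>k\<bar>" s] lpow_laurent_neg[OF s, of "nat \<bar>k\<bar>"] k(2)
    by (cases "k \<ge> 0") (auto simp: abs_if)
  obtain p' r' where pr': "deg_less p' (Suc n)" "deg_less r' n" "y = laurent s p' r'"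
    using step by auto
  have "c *\<^sub>R x + y = laurent s (smult c p + p') (smult c r + r')"
    by (simp add: laurent_add laurent_scale pr(3) pr'(3))
  moreover have "deg_less (smult c p + p') (Suc n)" "deg_less (smult c r + r') n"
    using pr pr' k(1) by (auto intro!: deg_less_add deg_less_smult elim!: deg_less_mono)
  ultimately show ?case
    by blast
qed

lemma V_add: "f \<in> V n \<Longrightarrow> g \<in> V n \<Longrightarrow> f + g \<in> V n"
  by (simp add: V_altdef span_add)

lemma V_scale: "f \<in> V n \<Longrightarrow> c *\<^sub>R f \<in> V n"
  by (simp add: V_altdef span_scale)

lemma V_shift:
  assumes "f \<in> V n" "\<bar>j\<bar> \<le> int i"
  shows "punctured (\<lambda>z. z powi j * f z) \<in> V (n + i)"
  using assms(1) unfolding V_altdef[of n]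
proof (induction rule: span_induct_alt)
  case base
  have "punctured (\<lambda>z. z powi j * 0 z) = 0"
    by (auto simp: punctured_def fun_eq_iff)
  then show ?case
    by (simp only: V_altdef span_zero)
next
  case (step c x y)
  then obtain k where k: "k \<in> {- int n..int n}" "x = lpow k"
    by auto
  have eq: "punctured (\<lambda>z. z powi j * (c *\<^sub>R x + y) z) = c *\<^sub>R lpow (j + k) + punctured (\<lambda>z. z powi j * y z)"
    by (auto simp: fun_eq_iff punctured_def lpow_def k(2) scaleR_fun_def scaleR_conv_of_real power_int_add algebra_simps)
  moreover have "lpow (j + k) \<in> V (n + i)"
    unfolding V_altdef using k assms(2) by (intro span_base imageI) auto
  ultimately show ?case
    unfolding eq using step(2) by (intro V_add V_scale)
qed

text \<open>Horner's scheme: in p = c + X p' the product by X = z + s/z is a sum of shifts by 1 and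
  -1, each of which enlarges the range of exponents by one.\<close>

lemma laurent_in_V_aux:
  "deg_less p n \<Longrightarrow> n \<le> Suc m \<Longrightarrow> laurent s p 0 \<in> V m"
proof (induction n arbitrary: p m)
  case 0
  then have "p = 0"
    by simp
  then show ?case by (simp only: V_altdef span_zero laurent_0)
next
  case (Suc n)
  obtain c p' where p: "p = pCons c p'"
    by (cases p)
  have 1: "laurent s [:c:] 0 = c *\<^sub>R lpow 0"
    by (auto simp: fun_eq_iff laurent_def punctured_def lpow_def scaleR_fun_def scaleR_conv_of_real)
  have "lpow 0 \<in> V m"
    unfolding V_altdef by (intro span_base imageI) auto
  then have c: "laurent s [:c:] 0 \<in> V m"
    unfolding 1 by (rule V_scale)
  show ?case
  proof (cases m)
    case 0
    then have "degree p = 0"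
      using Suc.prems by (metis deg_less_Suc_iff deg_less_mono le_zero_eq)
    then have "p = [:c:]"
      using p by (cases "p' = 0") auto
    then show ?thesis
      using c by simp
  next
    case (Suc m')
    have "deg_less p' n"
      using Suc.prems(1) by (auto simp: deg_less_def p coeff_pCons)
    then have *: "laurent s p' 0 \<in> V m'"
      using Suc.IH Suc.prems Suc by simp
    have "laurent s p 0 = laurent s [:c:] 0 + (punctured (\<lambda>z. z powi 1 * laurent s p' 0 z)
        + s *\<^sub>R punctured (\<lambda>z. z powi (-1) * laurent s p' 0 z))"
      by (auto simp: fun_eq_iff p laurent_def punctured_def scaleR_fun_def scaleR_conv_of_real field_simps)
    also have "\<dots> \<in> V m"
      using V_shift[OF *, of 1 1] V_shift[OF *, of "-1" 1] unfolding Suc by (intro V_add V_scale c[unfolded Suc]) auto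
    finally show ?thesis .
  qed
qed

lemma laurent_in_V:
  assumes "deg_less p (Suc n)" "deg_less r n"
  shows "laurent s p r \<in> V n"
proof -
  have "laurent s p r = laurent s p 0 + punctured (\<lambda>z. z powi 1 * laurent s r 0 z)"
    by (auto simp: fun_eq_iff laurent_def punctured_def)
  moreover have "punctured (\<lambda>z. z powi 1 * laurent s r 0 z) \<in> V n"
  proof (cases n)
    case 0
    then have "r = 0"
      using assms by simp
    moreover have "punctured (\<lambda>z. z powi 1 * laurent s 0 0 z) = 0"
      by (auto simp: fun_eq_iff punctured_def)
    ultimately show ?thesis
      by (simp only: V_altdef span_zero)
  next
    case (Suc m)
    then show ?thesis
      using V_shift[OF laurent_in_V_aux[of r n m s], of 1 1] assms by simp
  qed
  ultimately show ?thesis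
    using laurent_in_V_aux[of p "Suc n" n s] assms by (auto intro: V_add)
qed

section \<open>The weight and its symmetries\<close>

lemma prod_1_4: "(\<Prod>j=1..4. f j) = f 1 * f 2 * f 3 * f (4::nat)"
  by (simp add: numeral_eq_Suc atLeastAtMostSuc_conv mult_ac)

lemma continuous_on_qpoch_inf [continuous_intros]:
  assumes "norm q < 1" "continuous_on A f"
  shows "continuous_on A (\<lambda>z. qpoch_inf (f z) q)"
  using continuous_on_compose2[OF holomorphic_on_imp_continuous_on[OF qpoch_inf_holomorphic[OF assms(1)]] assms(2)]
  by simp

text \<open>The common shape of \<open>g w\<close> (with \<open>s = q\<close> and \<open>u = t\<close>) and of \<open>- k w\<close> (with \<open>s = 1\<close> and \<open>q t\<^sub>1, q t\<^sub>2\<close>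
  in place of \<open>t\<^sub>1, t\<^sub>2\<close>).\<close>

definition ker :: "real \<Rightarrow> real \<Rightarrow> (nat \<Rightarrow> real) \<Rightarrow> complex \<Rightarrow> complex" where
  "ker q s u z = (z - complex_of_real s / z) * qpoch_inf (of_real q * z\<^sup>2 / of_real s) (of_real q) *
     qpoch_inf (of_real q * of_real s / z\<^sup>2) (of_real q) /
     (\<Prod>j=1..4. qpoch_inf (of_real (u j) * z) (of_real q) * qpoch_inf (of_real s * of_real (u j) / z) (of_real q))"

text \<open>The map z -> s/z interchanges the two infinite products of the numerator and, for each
  j, those of the denominator; only z - s/z changes its sign.\<close>

lemma ker_reflect:
  fixes z :: complex
  assumes "z \<noteq> 0" "s \<noteq> 0"
  shows "ker q s u (s / z) = - ker q s u z"
proof -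
  have "of_real q * (of_real s / z)\<^sup>2 / of_real s = of_real q * of_real s / z\<^sup>2"
    "of_real q * of_real s / (of_real s / z)\<^sup>2 = of_real q * z\<^sup>2 / of_real s"
    "of_real s / z - of_real s / (of_real s / z) = - (z - of_real s / z)"
    using assms by (simp_all add: field_simps power2_eq_square)
  moreover have "(\<Prod>j=1..4. qpoch_inf (of_real (u j) * (of_real s / z)) q * qpoch_inf (of_real s * of_real (u j) / (of_real s / z)) q)
      = (\<Prod>j=1..4. qpoch_inf (of_real (u j) * z) q * qpoch_inf (of_real s * of_real (u j) / z) q)"
    using assms by (intro prod.cong refl) (simp add: mult.commute)
  moreover have "- a * b * c / d = - (a * c * b / d)" for a b c d :: complex
    by simp
  ultimately show ?thesis
    unfolding ker_def by (simp only:)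
qed

text \<open>A ring on which the denominator of \<open>ker\<close> has no zero, because all arguments
  of its infinite products stay inside the unit disc.\<close>

definition annulus :: "real \<Rightarrow> (nat \<Rightarrow> real) \<Rightarrow> complex set" where
  "annulus s u = - {0} \<inter> (\<Inter>j\<in>{1..4}. {z. \<bar>u j\<bar> * norm z < 1} \<inter> {z. \<bar>s * u j\<bar> < norm z})"

lemma open_annulus: "open (annulus s u)"
  unfolding annulus_def
  by (intro open_Int open_INT ballI open_Collect_less continuous_intros) auto

lemma ker_holomorphic:
  assumes "0 < q" "q < 1"
  shows "ker q s u holomorphic_on annulus s u"
proof -
  have "qpoch_inf (of_real (u j) * z) q * qpoch_inf (of_real s * of_real (u j) / z) q \<noteq> 0" if "z \<in> annulus s u" "j \<in> {1..4}" for z :: complex and j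
  proof -
    have "z \<noteq> 0" "\<bar>u j\<bar> * norm z < 1" "\<bar>s * u j\<bar> < norm z"
      using that by (auto simp: annulus_def)
    then have "norm (of_real (u j) * z) < 1" "norm (of_real s * of_real (u j) / z) < 1"
      by (simp_all add: norm_mult norm_divide abs_mult)
    then show ?thesis
      using assms qpoch_inf_nonzero[of q] by simp
  qed
  then show ?thesis
    unfolding ker_def using assms
    by (intro holomorphic_intros) (auto simp: annulus_def)
qed

lemma sphere_subset_annulus:
  assumes "\<And>j. j \<in> {1..4} \<Longrightarrow> \<bar>u j\<bar> < 1" "0 < s" "s \<le> 1" "s \<le> norm z" "norm z \<le> 1"
  shows "z \<in> annulus s u"
proof -
  have "\<bar>u j\<bar> * norm z < 1 \<and> \<bar>s * u j\<bar> < norm z" if "j \<in> {1..4}" for j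
  proof
    have u: "\<bar>u j\<bar> < 1"
      using assms(1) that .
    have "\<bar>u j\<bar> * norm z \<le> \<bar>u j\<bar>"
      using assms by (intro mult_right_le_one_le) auto
    then show "\<bar>u j\<bar> * norm z < 1"
      using u by simp
    have "\<bar>s * u j\<bar> < s * 1"
      using u assms by (simp add: abs_mult)
    then show "\<bar>s * u j\<bar> < norm z"
      using assms by simp
  qed
  moreover have "z \<noteq> 0"
    using assms by auto
  ultimately show ?thesis
    by (auto simp: annulus_def)
qed

section \<open>Fixed parameters: products with the weight and the mean \<open>E\<close>\<close>

locale cherednik =
  fixes q :: real and t :: "nat \<Rightarrow> real"
  assumes q: "0 < q" "q < 1" and t: "\<And>i. i \<in> {1..4} \<Longrightarrow> \<bar>t i\<bar> < 1"
begin

lemma norm_q: "norm (complex_of_real q) < 1"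
  using q by simp

lemmas rec = qpoch_inf_rec[OF norm_q]

lemma t_bounds: "\<bar>t 1\<bar> < 1" "\<bar>t 2\<bar> < 1" "\<bar>t 3\<bar> < 1" "\<bar>t 4\<bar> < 1"
  using t by simp_all

lemma prod_bound: "\<bar>a\<bar> < 1 \<Longrightarrow> \<bar>b\<bar> < 1 \<Longrightarrow> \<bar>a * b\<bar> < (1::real)"
  using mult_strict_mono[of "\<bar>a\<bar>" 1 "\<bar>b\<bar>" 1] by (simp add: abs_mult)

lemma q_bound: "\<bar>q\<bar> < 1"
  using q by simp

lemma ne_1:
  fixes z :: complex
  assumes "\<bar>a\<bar> < 1" "norm z = 1"
  shows "of_real a * z \<noteq> 1" "of_real a \<noteq> z"
  using norm_mult[of "complex_of_real a" z] assms by auto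

lemma poch_nonzero:
  fixes z :: complex
  assumes "norm z = 1" "\<bar>a\<bar> < 1"
  shows "qpoch_inf (of_real a * z) q \<noteq> 0" "qpoch_inf (of_real a / z) q \<noteq> 0"
  by (rule qpoch_inf_nonzero[OF norm_q]; use assms in \<open>simp add: norm_mult norm_divide\<close>)+

definition g :: "complex \<Rightarrow> complex" where
  "g z = z * (1 - complex_of_real (t 3) / z) * (1 - complex_of_real (t 4) / z)"

definition k :: "complex \<Rightarrow> complex" where
  "k z = (1 - complex_of_real (t 1) * z) * (1 - complex_of_real (t 2) * z) / z"

definition w where "w = w_cher t q"

definition den :: "complex \<Rightarrow> complex" where
  "den z = qpoch_inf (complex_of_real (t 1) * z) q * qpoch_inf (complex_of_real (t 2) * z) q *
     qpoch_inf (complex_of_real (t 3) * z) q * qpoch_inf (complex_of_real (t 4) * z) q *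
     (qpoch_inf (complex_of_real (t 3) / z) q * qpoch_inf (complex_of_real (t 4) / z) q * qpoch_inf (of_real (q * t 1) / z) q * qpoch_inf (of_real (q * t 2) / z) q)"

lemma w_eq:
  fixes z :: complex
  shows "w z = qpoch_inf q q * qpoch_inf (z\<^sup>2) q * qpoch_inf (q / z\<^sup>2) q / den z"
proof -
  have "of_real q * z powi (-2) = q / z\<^sup>2"
    by (simp add: power_int_minus divide_inverse)
  then show ?thesis
    unfolding w_def w_cher_def qpochs_inf_def prod_1_4 den_def by (simp add: mult.assoc)
qed

lemma den_nonzero:
  assumes "norm z = 1"
  shows "den z \<noteq> 0"
  unfolding den_def mult_eq_0_iff de_Morgan_disj
  using prod_bound[OF q_bound t_bounds(1)] prod_bound[OF q_bound t_bounds(2)]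
  by (intro conjI poch_nonzero assms t_bounds)

lemma w_continuous: "continuous_on (sphere 0 1) w"
proof -
  have "continuous_on (sphere 0 1) den"
    unfolding den_def[abs_def] by (intro continuous_intros norm_q) auto
  then have "continuous_on (sphere 0 1) (\<lambda>z::complex. qpoch_inf q q * qpoch_inf (z\<^sup>2) q * qpoch_inf (q / z\<^sup>2) q / den z)"
    by (intro continuous_intros norm_q) (auto simp: den_nonzero)
  then show ?thesis
    by (simp add: w_eq[abs_def])
qed

text \<open>The first factors of the products in q/z^2, t_3/z and t_4/z are split off. The last two
  cancel against \<open>g\<close>, and z (1 - q/z^2) = z - q/z is the antisymmetric
  prefactor.\<close>

lemma g_w:
  fixes z :: complex
  assumes "norm z = 1"
  shows "g z * w z = qpoch_inf q q * ker q q t z"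
proof -
  have z: "z \<noteq> 0"
    using assms by auto
  have 1: "qpoch_inf (q / z\<^sup>2) q = (1 - q / z\<^sup>2) * qpoch_inf (q * q / z\<^sup>2) q"
    "qpoch_inf (t 3 / z) q = (1 - t 3 / z) * qpoch_inf (q * t 3 / z) q"
    "qpoch_inf (t 4 / z) q = (1 - t 4 / z) * qpoch_inf (q * t 4 / z) q"
    using rec[of "q / z\<^sup>2"] rec[of "t 3 / z"] rec[of "t 4 / z"] by (simp_all add: mult_ac)
  have 2: "1 - t 3 / z \<noteq> 0" "1 - t 4 / z \<noteq> 0"
    using ne_1(2)[of "t 3" z] ne_1(2)[of "t 4" z] assms t_bounds z by auto
  have 3: "z - q / z = z * (1 - q / z\<^sup>2)"
    using z by (simp add: field_simps power2_eq_square)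
  have 4: "of_real q * z\<^sup>2 / of_real q = z\<^sup>2"
    using q by simp
  show ?thesis
    unfolding w_eq den_def g_def ker_def prod_1_4 1 3 4 using 2 z q by (simp add: mult_ac)
qed

text \<open>Here the products in z^2, t_1 z and t_2 z are split. With q t_1, q t_2 in place of t_1,
  t_2 all arguments then pair up under z -> 1/z.\<close>

lemma k_w:
  fixes z :: complex
  assumes "norm z = 1"
  shows "k z * w z = - qpoch_inf q q * ker q 1 (t(1 := q * t 1, 2 := q * t 2)) z"
proof -
  have z: "z \<noteq> 0"
    using assms by auto
  have 1: "qpoch_inf (z\<^sup>2) q = (1 - z\<^sup>2) * qpoch_inf (q * z\<^sup>2) q"
    "qpoch_inf (t 1 * z) q = (1 - t 1 * z) * qpoch_inf (q * t 1 * z) q"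
    "qpoch_inf (t 2 * z) q = (1 - t 2 * z) * qpoch_inf (q * t 2 * z) q"
    using rec[of "z\<^sup>2"] rec[of "t 1 * z"] rec[of "t 2 * z"] by (simp_all add: mult_ac)
  have 2: "1 - t 1 * z \<noteq> 0" "1 - t 2 * z \<noteq> 0"
    using ne_1(1)[of "t 1" z] ne_1(1)[of "t 2" z] assms t_bounds by auto
  have 3: "z - 1 / z = - ((1 - z\<^sup>2) / z)"
    using z by (simp add: field_simps power2_eq_square)
  show ?thesis
    unfolding w_eq den_def k_def ker_def prod_1_4 1 using 2 3 by (simp add: mult_ac)
qed

lemma w_shift:
  fixes z :: complex
  assumes "norm z = 1"
  shows "(1 - t 1 * z) * (1 - q * t 1 / z) * w z = w_cher (t(1 := q * t 1)) q z"
proof -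
  have c: "cherednik q (t(1 := q * t 1))"
    using q t t_bounds prod_bound[OF q_bound] by unfold_locales auto
  have 1: "qpoch_inf (t 1 * z) q = (1 - t 1 * z) * qpoch_inf (q * t 1 * z) q"
    "qpoch_inf (q * t 1 / z) q = (1 - q * t 1 / z) * qpoch_inf (q * (q * t 1) / z) q"
    using rec[of "t 1 * z"] rec[of "q * t 1 / z"] by (simp_all add: mult_ac)
  have 2: "1 - t 1 * z \<noteq> 0" "1 - q * t 1 / z \<noteq> 0"
    using ne_1(1)[OF _ assms, of "t 1"] ne_1(2)[OF _ assms, of "q * t 1"] t_bounds prod_bound[OF q_bound, of "t 1"] assms
    by auto
  show ?thesis
    unfolding cherednik.w_eq[OF c, unfolded cherednik.w_def[OF c]] w_eq cherednik.den_def[OF c] den_def using 1 2 assms by (auto simp: mult_ac)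
qed

definition E :: "(complex \<Rightarrow> complex) \<Rightarrow> complex" where
  "E f = circle_mean (\<lambda>z. f z * w z)"

lemma form_eq_E: "form_cher t q f h = E (\<lambda>z. f z * h z)"
  by (simp add: form_cher_def E_def circle_mean_def w_def)

lemma E_cong: "(\<And>z. norm z = 1 \<Longrightarrow> f z = h z) \<Longrightarrow> E f = E h"
  unfolding E_def by (intro circle_mean_cong) simp

lemma E_add:
  assumes "continuous_on (sphere 0 1) f" "continuous_on (sphere 0 1) h"
  shows "E (\<lambda>z. f z + h z) = E f + E h"
  unfolding E_def ring_distribs using assms w_continuous
  by (intro circle_mean_add continuous_intros)

lemma E_cmult: "E (\<lambda>z. c * f z) = c * E f"
  unfolding E_def by (simp add: circle_mean_cmult mult.assoc)

text \<open>The map z -> q/z moves the unit circle to radius q, so the antisymmetry of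
  \<open>ker\<close> makes the mean its own negative only after a contour shift, for which
  holomorphy is used.\<close>

lemma E_g_symmetric: "E (\<lambda>z. g z * cpoly p (z + q / z)) = 0"
proof -
  define F where "F z = ker q q t z * cpoly p (z + q / z)" for z :: complex
  have "F holomorphic_on annulus q t"
    unfolding F_def using q by (intro holomorphic_intros ker_holomorphic) (auto simp: annulus_def)
  then have "circle_mean (\<lambda>z. F (q / z)) = circle_mean F"
    using q t by (intro circle_mean_reflect[of _ "annulus q t"] open_annulus sphere_subset_annulus) auto
  moreover have "circle_mean (\<lambda>z. F (q / z)) = circle_mean (\<lambda>z. -1 * F z)"
  proof (rule circle_mean_cong)
    fix z :: complex assume "norm z = 1"
    then have "z \<noteq> 0"
      by auto
    then show "F (q / z) = -1 * F z"
      using q ker_reflect[of z q q] by (simp add: F_def add.commute)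
  qed
  ultimately have "circle_mean F = 0"
    unfolding circle_mean_cmult by simp
  moreover have "E (\<lambda>z. g z * cpoly p (z + q / z)) = circle_mean (\<lambda>z. qpoch_inf q q * F z)"
    unfolding E_def
  proof (rule circle_mean_cong)
    fix z :: complex assume z: "norm z = 1"
    have "g z * cpoly p (z + q / z) * w z = (g z * w z) * cpoly p (z + q / z)"
      by simp
    then show "g z * cpoly p (z + q / z) * w z = qpoch_inf q q * F z"
      unfolding g_w[OF z] F_def by simp
  qed
  ultimately show ?thesis
    by (simp add: circle_mean_cmult)
qed

text \<open>Here z -> 1/z preserves the circle, and antisymmetry alone makes the mean
  vanish.\<close>

lemma E_k_symmetric: "E (\<lambda>z. k z * cpoly p (z + 1 / z)) = 0"
proof -
  define F where "F z = ker q 1 (t(1 := q * t 1, 2 := q * t 2)) z * cpoly p (z + 1 / z)" for z :: complex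
  have "circle_mean (\<lambda>z. F (1 / z)) = circle_mean (\<lambda>z. -1 * F z)"
  proof (rule circle_mean_cong)
    fix z :: complex assume "norm z = 1"
    then have "z \<noteq> 0"
      by auto
    then show "F (1 / z) = -1 * F z"
      using ker_reflect[of z 1 q] by (simp add: F_def add.commute)
  qed
  then have "circle_mean F = 0"
    unfolding circle_mean_cmult circle_mean_inverse by simp
  moreover have "E (\<lambda>z. k z * cpoly p (z + 1 / z)) = circle_mean (\<lambda>z. - qpoch_inf q q * F z)"
    unfolding E_def
  proof (rule circle_mean_cong)
    fix z :: complex assume z: "norm z = 1"
    have "k z * cpoly p (z + 1 / z) * w z = (k z * w z) * cpoly p (z + 1 / z)"
      by simp
    then show "k z * cpoly p (z + 1 / z) * w z = - qpoch_inf q q * F z"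
      unfolding k_w[OF z] F_def by simp
  qed
  ultimately show ?thesis
    by (simp only: circle_mean_cmult mult_zero_right)
qed

lemma E_shift: "cherednik.E q (t(1 := q * t 1)) f = E (\<lambda>z. (1 - t 1 * z) * (1 - q * t 1 / z) * f z)"
proof -
  have c: "cherednik q (t(1 := q * t 1))"
    using q t t_bounds prod_bound[OF q_bound] by unfold_locales auto
  show ?thesis
    unfolding cherednik.E_def[OF c] cherednik.w_def[OF c] E_def
    by (intro circle_mean_cong) (simp only: w_shift[symmetric] mult_ac)
qed

end

section \<open>Low moments\<close>

text \<open>\<open>m0\<close>, \<open>m1\<close>, \<open>n1\<close> stand for the means of 1, z,
  1/z. The hypotheses say that \<open>g\<close> and \<open>k\<close> have mean zero; the first
  factor on the left is the mean of (1 - t_1 z)(1 - q t_1/z).\<close>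

lemma first_moment_elimination:
  fixes q t1 t2 t3 t4 m0 m1 n1 :: complex
  assumes "m1 - (t3 + t4) * m0 + t3 * t4 * n1 = 0" "n1 - (t1 + t2) * m0 + t1 * t2 * m1 = 0"
  shows "(- t1 * m1 + (1 + q * t1\<^sup>2) * m0 - q * t1 * n1) * (1 - t1 * t2 * t3 * t4) =
           m0 * ((1 - q * t1 * t2) * (1 - t1 * t3) * (1 - t1 * t4))"
proof -
  define r1 r2 where "r1 = m1 - (t3 + t4) * m0 + t3 * t4 * n1" and "r2 = n1 - (t1 + t2) * m0 + t1 * t2 * m1"
  \<comment> \<open>\<open>r1 - t3 * t4 * r2\<close> is free of \<open>n1\<close> and
    \<open>r2 - t1 * t2 * r1\<close> is free of \<open>m1\<close>; the other moment keeps the factor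
    1 - t1 t2 t3 t4.\<close>
  have "(- t1 * m1 + (1 + q * t1\<^sup>2) * m0 - q * t1 * n1) * (1 - t1 * t2 * t3 * t4) -
      m0 * ((1 - q * t1 * t2) * (1 - t1 * t3) * (1 - t1 * t4)) =
      - t1 * (r1 - t3 * t4 * r2) - q * t1 * (r2 - t1 * t2 * r1)"
    unfolding r1_def r2_def by (simp add: algebra_simps power2_eq_square)
  then show ?thesis
    using assms by (simp add: r1_def r2_def)
qed

text \<open>The same for the mean of g^2. Two further relations, from g (z + q/z) and k (z + 1/z),
  remove \<open>m2\<close> and \<open>n2\<close>; then \<open>m1\<close> and \<open>n1\<close> go as
  before, and the coefficient left at \<open>m0\<close> factors.\<close>

lemma second_moment_elimination:
  fixes q t1 t2 t3 t4 m0 m1 m2 n1 n2 :: complex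
  defines "c1 \<equiv> t3 + t4" and "c2 \<equiv> t3 * t4" and "d1 \<equiv> t1 + t2" and "d2 \<equiv> t1 * t2"
  assumes "m1 - c1 * m0 + c2 * n1 = 0" "n1 - d1 * m0 + d2 * m1 = 0"
    "m2 - c1 * m1 + (c2 + q) * m0 - q * c1 * n1 + q * c2 * n2 = 0"
    "n2 - d1 * n1 + (1 + d2) * m0 - d1 * m1 + d2 * m2 = 0"
  shows "(m2 - 2 * c1 * m1 + (c1\<^sup>2 + 2 * c2) * m0 - 2 * c1 * c2 * n1 + c2\<^sup>2 * n2) *
           ((1 - d2 * c2) * (1 - q * (d2 * c2))) =
         (c2 - q) * (1 - c2) * (1 - t1 * t3) * (1 - t1 * t4) * (1 - t2 * t3) * (1 - t2 * t4) * m0"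
proof -
  define r1 r2 r3 r4 where "r1 = m1 - c1 * m0 + c2 * n1" and "r2 = n1 - d1 * m0 + d2 * m1"
    and "r3 = m2 - c1 * m1 + (c2 + q) * m0 - q * c1 * n1 + q * c2 * n2"
    and "r4 = n2 - d1 * n1 + (1 + d2) * m0 - d1 * m1 + d2 * m2"
  define A where "A = c1 - q * c2 * d1 + c2\<^sup>2 * (d1 - d2 * c1) - 2 * c1 * (1 - q * (d2 * c2))"
  define B where "B = q * c1 - q * c2 * d1 + c2\<^sup>2 * (d1 - d2 * q * c1) - 2 * c1 * c2 * (1 - q * (d2 * c2))"
  define G where "G = m2 - 2 * c1 * m1 + (c1\<^sup>2 + 2 * c2) * m0 - 2 * c1 * c2 * n1 + c2\<^sup>2 * n2"
  define C where "C = - (c2 + q) + q * c2 * (1 + d2) + c2\<^sup>2 * (d2 * (c2 + q) - (1 + d2)) +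
    (c1\<^sup>2 + 2 * c2) * (1 - q * (d2 * c2))"
  \<comment> \<open>The multipliers of \<open>r3\<close> and \<open>r4\<close> are chosen to match
    the coefficients of \<open>m2\<close> and \<open>n2\<close>; \<open>A\<close>, \<open>B\<close>,
    \<open>C\<close> collect what remains.\<close>
  have 1: "G * (1 - q * (d2 * c2)) = (1 - c2\<^sup>2 * d2) * r3 + (c2\<^sup>2 - q * c2) * r4 + A * m1 + B * n1 + C * m0"
    unfolding G_def A_def B_def C_def r3_def r4_def by (simp add: algebra_simps power2_eq_square)
  have 2: "m1 * (1 - d2 * c2) = r1 - c2 * r2 + (c1 - c2 * d1) * m0"
    "n1 * (1 - d2 * c2) = r2 - d2 * r1 + (d1 - d2 * c1) * m0"
    unfolding r1_def r2_def by (simp_all add: algebra_simps)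
  have 3: "A * (c1 - c2 * d1) + B * (d1 - d2 * c1) + C * (1 - d2 * c2) =
      (c2 - q) * (1 - c2) * (1 - t1 * t3) * (1 - t1 * t4) * (1 - t2 * t3) * (1 - t2 * t4)"
    unfolding A_def B_def C_def c1_def c2_def d1_def d2_def by (simp add: algebra_simps power2_eq_square)
  have "G * ((1 - d2 * c2) * (1 - q * (d2 * c2))) = (G * (1 - q * (d2 * c2))) * (1 - d2 * c2)"
    by simp
  also have "\<dots> = A * (m1 * (1 - d2 * c2)) + B * (n1 * (1 - d2 * c2)) + C * (1 - d2 * c2) * m0"
    unfolding 1 using assms(7,8) by (simp add: r3_def r4_def algebra_simps)
  also have "\<dots> = (A * (c1 - c2 * d1) + B * (d1 - d2 * c1) + C * (1 - d2 * c2)) * m0"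
    unfolding 2 using assms(5,6) by (simp add: r1_def r2_def algebra_simps)
  finally show ?thesis
    unfolding 3 G_def .
qed

context cherednik
begin

definition e :: real where "e = t 1 * t 2 * t 3 * t 4"

definition quad :: "complex \<Rightarrow> complex \<Rightarrow> complex \<Rightarrow> complex \<Rightarrow> complex \<Rightarrow> complex \<Rightarrow> complex" where
  "quad a b c d f z = a * z\<^sup>2 + b * z + c + d * (1 / z) + f * (1 / z\<^sup>2)"

definition m0 where "m0 = E (\<lambda>z. 1)"
definition m1 where "m1 = E (\<lambda>z. z)"
definition m2 where "m2 = E (\<lambda>z. z\<^sup>2)"
definition n1 where "n1 = E (\<lambda>z. 1 / z)"
definition n2 where "n2 = E (\<lambda>z. 1 / z\<^sup>2)"

lemma E_quad: "E (quad a b c d f) = a * m2 + b * m1 + c * m0 + d * n1 + f * n2"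
proof -
  have c0: "E (\<lambda>z. c) = c * m0"
    using E_cmult[of c "\<lambda>z. 1"] by (simp add: m0_def)
  have nz: "z \<noteq> 0" if "z \<in> sphere 0 1" for z :: complex
    using that by auto
  show ?thesis
    unfolding quad_def[abs_def]
    by (subst E_add, (intro continuous_intros; auto dest: nz), (intro continuous_intros; auto dest: nz))+
       (simp only: E_cmult c0 m0_def m1_def m2_def n1_def n2_def)
qed

lemma norm_1_nonzero: "norm z = 1 \<Longrightarrow> z \<noteq> (0::complex)"
  by auto

lemma relations:
  fixes c1 c2 d1 d2 :: complex
  defines "c1 \<equiv> complex_of_real (t 3 + t 4)" and "c2 \<equiv> complex_of_real (t 3 * t 4)"
    and "d1 \<equiv> complex_of_real (t 1 + t 2)" and "d2 \<equiv> complex_of_real (t 1 * t 2)"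
  shows "m1 - c1 * m0 + c2 * n1 = 0"
    and "n1 - d1 * m0 + d2 * m1 = 0"
    and "m2 - c1 * m1 + (c2 + q) * m0 - q * c1 * n1 + q * c2 * n2 = 0"
    and "n2 - d1 * n1 + (1 + d2) * m0 - d1 * m1 + d2 * m2 = 0"
    and "E (\<lambda>z. (g z)\<^sup>2) = m2 - 2 * c1 * m1 + (c1\<^sup>2 + 2 * c2) * m0 - 2 * c1 * c2 * n1 + c2\<^sup>2 * n2"
proof -
  have "E (\<lambda>z. g z * cpoly 1 (z + q / z)) = E (quad 0 1 (- c1) c2 0)"
    by (rule E_cong, drule norm_1_nonzero) (simp add: quad_def g_def c1_def c2_def field_simps)
  then show "m1 - c1 * m0 + c2 * n1 = 0"
    unfolding E_g_symmetric E_quad by simp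
  have "E (\<lambda>z. k z * cpoly 1 (z + 1 / z)) = E (quad 0 d2 (- d1) 1 0)"
    by (rule E_cong, drule norm_1_nonzero) (simp add: quad_def k_def d1_def d2_def field_simps)
  then show "n1 - d1 * m0 + d2 * m1 = 0"
    unfolding E_k_symmetric E_quad by (simp add: algebra_simps)
  have "E (\<lambda>z. g z * cpoly [:0, 1:] (z + q / z)) = E (quad 1 (- c1) (c2 + q) (- q * c1) (q * c2))"
    by (rule E_cong, drule norm_1_nonzero) (simp add: quad_def g_def c1_def c2_def field_simps power2_eq_square)
  then show "m2 - c1 * m1 + (c2 + q) * m0 - q * c1 * n1 + q * c2 * n2 = 0"
    unfolding E_g_symmetric E_quad by simp
  have "E (\<lambda>z. k z * cpoly [:0, 1:] (z + 1 / z)) = E (quad d2 (- d1) (1 + d2) (- d1) 1)"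
    by (rule E_cong, drule norm_1_nonzero) (simp add: quad_def k_def d1_def d2_def field_simps power2_eq_square)
  then show "n2 - d1 * n1 + (1 + d2) * m0 - d1 * m1 + d2 * m2 = 0"
    unfolding E_k_symmetric E_quad by (simp add: algebra_simps)
  have "E (\<lambda>z. (g z)\<^sup>2) = E (quad 1 (- 2 * c1) (c1\<^sup>2 + 2 * c2) (- 2 * c1 * c2) (c2\<^sup>2))"
    by (rule E_cong, drule norm_1_nonzero) (simp add: quad_def g_def c1_def c2_def field_simps power2_eq_square)
  then show "E (\<lambda>z. (g z)\<^sup>2) = m2 - 2 * c1 * m1 + (c1\<^sup>2 + 2 * c2) * m0 - 2 * c1 * c2 * n1 + c2\<^sup>2 * n2"
    unfolding E_quad by simp
qed

text \<open>This is the assumption \<open>mass\<close> of \<open>aw_moments\<close> at k = 0; larger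
  k follow on replacing t_1 by t_1 q^k.\<close>

lemma mass_shift:
  "cherednik.E q (t(1 := q * t 1)) (\<lambda>z. 1) * of_real (1 - e) =
     E (\<lambda>z. 1) * of_real ((1 - q * t 1 * t 2) * (1 - t 1 * t 3) * (1 - t 1 * t 4))"
proof -
  have "E (\<lambda>z. (1 - t 1 * z) * (1 - q * t 1 / z) * 1) = E (quad 0 (- t 1) (1 + q * (t 1)\<^sup>2) (- (q * t 1)) 0)"
    by (rule E_cong, drule norm_1_nonzero) (simp add: quad_def field_simps power2_eq_square)
  then have *: "cherednik.E q (t(1 := q * t 1)) (\<lambda>z. 1) = - t 1 * m1 + (1 + q * (t 1)\<^sup>2) * m0 - q * t 1 * n1"
    unfolding E_shift E_quad by simp
  show ?thesis
    unfolding * m0_def[symmetric] e_def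
    using first_moment_elimination[of m1 "t 3" "t 4" m0 n1 "t 1" "t 2" q] relations(1,2) by simp
qed

lemma g_square_mean:
  "E (\<lambda>z. (g z)\<^sup>2) * of_real ((1 - e) * (1 - q * e)) =
     of_real ((t 3 * t 4 - q) * (1 - t 3 * t 4) * (1 - t 1 * t 3) * (1 - t 1 * t 4) * (1 - t 2 * t 3) * (1 - t 2 * t 4)) * E (\<lambda>z. 1)"
  unfolding relations(5) m0_def[symmetric] e_def
  using second_moment_elimination[of m1 "t 3" "t 4" m0 n1 "t 1" "t 2" m2 q n2] relations(1-4)
  by (simp add: mult.assoc)

end

section \<open>Nondegeneracy of the form\<close>

text \<open>The mean of F is half that of F(z) + F(1/z), so positivity is only asked of the
  symmetrised integrand.\<close>

lemma circle_mean_symmetric_eq_0: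
  assumes F: "continuous_on (sphere 0 1) F" and \<rho>: "continuous_on (sphere 0 1) \<rho>"
    and nonneg: "\<And>z. norm z = 1 \<Longrightarrow> 0 \<le> \<rho> z" and c: "c \<noteq> 0"
    and eq: "\<And>z. norm z = 1 \<Longrightarrow> F z + F (1 / z) = c * of_real (\<rho> z)"
    and zero: "circle_mean F = 0" and z: "norm z = 1"
  shows "\<rho> z = 0"
proof -
  have "continuous_on (sphere 0 1) (\<lambda>z. F (1 / z))"
    by (rule continuous_on_compose2[OF F]) (auto intro!: continuous_intros simp: norm_divide)
  then have "circle_mean (\<lambda>z. F z + F (1 / z)) = 0"
    using F zero by (simp add: circle_mean_add circle_mean_inverse)
  moreover have "circle_mean (\<lambda>z. F z + F (1 / z)) = c * circle_mean (\<lambda>z. of_real (\<rho> z))"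
    unfolding circle_mean_cmult[symmetric] by (intro circle_mean_cong eq)
  ultimately have "circle_mean (\<lambda>z. of_real (\<rho> z)) = 0"
    using c by simp
  then show ?thesis
    using circle_mean_nonneg_eq_0[OF \<rho> nonneg] z by simp
qed

lemma inverse_eq_cnj:
  assumes "norm z = 1"
  shows "1 / z = cnj z"
proof -
  have "z * cnj z = 1"
    using complex_norm_square[of z] assms by simp
  moreover from this have "z \<noteq> 0"
    by auto
  ultimately show ?thesis
    by (simp add: field_simps)
qed

lemma circle_joukowski: "norm z = 1 \<Longrightarrow> z + 1 / z = of_real (2 * Re z)"
  by (simp only: inverse_eq_cnj complex_add_cnj)

text \<open>Even without the points 1 and -1, where the later weight \<open>\<omega>\<close>
  vanishes, 2 Re z covers the whole open interval from -2 to 2.\<close>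

lemma poly_eq_0_if_zero_on_circle:
  fixes p :: "real poly"
  assumes "\<And>z. norm z = 1 \<Longrightarrow> Im z \<noteq> 0 \<Longrightarrow> poly p (2 * Re z) = 0"
  shows "p = 0"
proof (rule ccontr)
  assume "p \<noteq> 0"
  then have "finite {x. poly p x = 0}"
    by (rule poly_roots_finite)
  moreover have "{-2<..<2} \<subseteq> {x. poly p x = 0}"
  proof
    fix x :: real assume x: "x \<in> {-2<..<2}"
    define z where "z = Complex (x / 2) (sqrt (1 - (x / 2)\<^sup>2))"
    have "\<bar>x / 2\<bar> < 1"
      using x by auto
    then have "(x / 2)\<^sup>2 < 1"
      by (simp add: abs_square_less_1)
    then have "norm z = 1" "Im z \<noteq> 0"
      by (simp_all add: z_def cmod_def)
    then show "x \<in> {x. poly p x = 0}"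
      using assms[of z] by (simp add: z_def)
  qed
  moreover have "infinite {-2<..<2::real}"
    by simp
  ultimately show False
    using finite_subset by blast
qed

lemma V_continuous:
  assumes "f \<in> V n"
  shows "continuous_on (sphere 0 1) f"
proof -
  obtain p r where f: "f = laurent 1 p r"
    using V_laurent[of 1 f n] assms by auto
  have "continuous_on (sphere 0 1) (\<lambda>z. cpoly p (z + 1 / z) + z * cpoly r (z + 1 / z))"
    by (intro continuous_intros) auto
  then show ?thesis
    by (rule continuous_on_eq) (auto simp: f laurent_def punctured_def)
qed

context cherednik
begin

abbreviation t' :: "nat \<Rightarrow> real" where
  "t' \<equiv> t(1 := q * t 1, 2 := q * t 2)"

lemma t'_bound: "j \<in> {1..4} \<Longrightarrow> \<bar>t' j\<bar> < 1"
  using t t_bounds prod_bound[OF q_bound] by auto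

definition K :: "complex \<Rightarrow> complex" where
  "K = ker q 1 t'"

lemma K_continuous: "continuous_on (sphere 0 1) K"
proof -
  have "sphere 0 1 \<subseteq> annulus 1 t'"
    by (intro subsetI sphere_subset_annulus t'_bound) auto
  then show ?thesis
    unfolding K_def using ker_holomorphic[OF q] holomorphic_on_imp_continuous_on continuous_on_subset by blast
qed

lemma K_inverse: "norm z = 1 \<Longrightarrow> K (1 / z) = - K z"
  using ker_reflect[of z 1 q t'] norm_1_nonzero[of z] unfolding K_def by simp

text \<open>On the unit circle this is the Askey-Wilson weight with parameters q t_1, q t_2, t_3,
  t_4: there |1 - z^2| = 2 |Im z| is the first factor of |(z^2; q)|.\<close>

definition \<omega> :: "complex \<Rightarrow> real" where
  "\<omega> z = 4 * (Im z)\<^sup>2 * (norm (qpoch_inf (of_real q * z\<^sup>2) q))\<^sup>2 /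
     (norm (\<Prod>j=1..4. qpoch_inf (of_real (t' j) * z) q))\<^sup>2"

lemma \<omega>_den_nonzero: "norm z = 1 \<Longrightarrow> (\<Prod>j=1..4. qpoch_inf (of_real (t' j) * z) q) \<noteq> 0"
  using t'_bound poch_nonzero(1) by (auto simp del: fun_upd_apply)

lemma \<omega>_nonneg: "0 \<le> \<omega> z"
  by (simp add: \<omega>_def)

lemma \<omega>_continuous: "continuous_on (sphere 0 1) \<omega>"
  unfolding \<omega>_def[abs_def]
  by (intro continuous_intros norm_q) (use \<omega>_den_nonzero in \<open>auto simp del: fun_upd_apply\<close>)

lemma \<omega>_nonzero:
  assumes "norm z = 1" "Im z \<noteq> 0"
  shows "\<omega> z \<noteq> 0"
proof -
  have "qpoch_inf (of_real q * z\<^sup>2) q \<noteq> 0"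
    using assms q by (intro poch_nonzero) (simp_all add: norm_power)
  then show ?thesis
    using assms \<omega>_den_nonzero[of z] by (simp add: \<omega>_def)
qed

text \<open>On the circle 1/z is the conjugate of z, so the factors of \<open>K\<close> form
  conjugate pairs, and (1/z - z)(z - 1/z) = 4 (Im z)^2.\<close>

lemma K_\<omega>:
  assumes "norm z = 1"
  shows "(1 / z - z) * K z = of_real (\<omega> z)"
proof -
  define A where "A = qpoch_inf (of_real q * z\<^sup>2) q"
  define D where "D = (\<Prod>j=1..4. qpoch_inf (of_real (t' j) * z) q)"
  have A: "qpoch_inf (of_real q * of_real 1 / z\<^sup>2) q = cnj A"
  proof -
    have "of_real q / z\<^sup>2 = of_real q * (1 / z)\<^sup>2"
      by (simp add: power_divide)
    then show ?thesis
      unfolding A_def qpoch_inf_cnj[OF norm_q] by (simp add: inverse_eq_cnj[OF assms])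
  qed
  have D: "(\<Prod>j=1..4. qpoch_inf (of_real 1 * of_real (t' j) / z) q) = cnj D"
  proof -
    have "of_real 1 * of_real x / z = of_real x * cnj z" for x
      unfolding inverse_eq_cnj[OF assms, symmetric] by simp
    then have "qpoch_inf (of_real 1 * of_real (t' j) / z) q = cnj (qpoch_inf (of_real (t' j) * z) q)" for j
      unfolding qpoch_inf_cnj[OF norm_q] by (simp only: complex_cnj_mult complex_cnj_complex_of_real)
    then show ?thesis
      unfolding D_def by (simp del: fun_upd_apply)
  qed
  have z: "1 / z - z = - 2 * \<i> * of_real (Im z)"
    unfolding inverse_eq_cnj[OF assms] by (simp add: complex_eq_iff)
  define y where "y = 1 / z - z"
  have "K z = - y * A * cnj A / (D * cnj D)"
    unfolding K_def ker_def prod.distrib A D by (simp add: A_def D_def y_def del: fun_upd_apply)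
  then have "y * K z = - (y\<^sup>2) * (A * cnj A) / (D * cnj D)"
    by (simp add: power2_eq_square)
  also have "\<dots> = of_real (\<omega> z)"
    unfolding y_def z \<omega>_def A_def[symmetric] D_def[symmetric] by (simp add: power_mult_distrib flip: complex_norm_square)
  finally show ?thesis
    by (simp add: y_def)
qed

lemma k_w': "norm z = 1 \<Longrightarrow> k z * w z = - qpoch_inf q q * K z"
  using k_w by (simp add: K_def)

lemma k_diff:
  assumes "z \<noteq> 0"
  shows "k z - k (1 / z) = complex_of_real (1 - t 1 * t 2) * (1 / z - z)"
  using assms by (simp add: k_def field_simps)

lemma k_cnj: "norm z = 1 \<Longrightarrow> k (1 / z) = cnj (k z)"
  by (simp only: inverse_eq_cnj) (simp add: k_def)

lemma k_nonzero: "norm z = 1 \<Longrightarrow> k z \<noteq> 0"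
  using ne_1(1)[of "t 1" z] ne_1(1)[of "t 2" z] t_bounds norm_1_nonzero[of z] by (auto simp: k_def)

lemma k_continuous: "continuous_on (sphere 0 1) k"
  unfolding k_def[abs_def] by (intro continuous_intros) auto

lemma cpoly_circle: "norm z = 1 \<Longrightarrow> cpoly p (z + 1 / z) = of_real (poly p (2 * Re z))"
  by (simp only: circle_joukowski cpoly_of_real)

lemma one_minus_nonzero: "complex_of_real (1 - t 1 * t 2) \<noteq> 0"
proof -
  have "t 1 * t 2 \<noteq> 1"
    using prod_bound[OF t_bounds(1,2)] by auto
  then show ?thesis
    by (simp del: of_real_diff)
qed

lemma qq_nonzero: "qpoch_inf q q \<noteq> 0"
  using qpoch_inf_nonzero[OF norm_q norm_q] .

text \<open>Up to a constant the weight is K/k. As \<open>K\<close> is antisymmetric, symmetrising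
  gives a multiple of K (k(z) - k(1/z)) / |k|^2, which \<open>k_diff\<close> and
  \<open>K_\<omega>\<close> turn into a nonzero constant times \<open>\<omega>\<close> /
  |k|^2.\<close>

lemma symmetric_norm_nonzero:
  assumes "E (\<lambda>z. (cpoly p (z + 1 / z))\<^sup>2) = 0"
  shows "p = 0"
proof (rule poly_eq_0_if_zero_on_circle)
  fix z :: complex assume z: "norm z = 1" "Im z \<noteq> 0"
  define \<rho> where "\<rho> z = \<omega> z * (poly p (2 * Re z))\<^sup>2 / (norm (k z))\<^sup>2" for z
  define F where "F z = (cpoly p (z + 1 / z))\<^sup>2 * K z / k z" for z
  have "\<rho> z = 0"
  proof (rule circle_mean_symmetric_eq_0[of F \<rho> "- complex_of_real (1 - t 1 * t 2)"])
    show "continuous_on (sphere 0 1) F" "continuous_on (sphere 0 1) \<rho>"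
      unfolding F_def \<rho>_def by (intro continuous_intros K_continuous k_continuous \<omega>_continuous; use k_nonzero in auto)+
    show "0 \<le> \<rho> z" for z
      by (simp add: \<rho>_def \<omega>_nonneg)
    show "- complex_of_real (1 - t 1 * t 2) \<noteq> 0"
      using one_minus_nonzero by simp
    show "F z + F (1 / z) = - of_real (1 - t 1 * t 2) * of_real (\<rho> z)" if z: "norm z = 1" for z
    proof -
      have nz: "z \<noteq> 0" "k z \<noteq> 0" "k (1 / z) \<noteq> 0"
        using z k_nonzero[of z] k_nonzero[of "1 / z"] by (auto simp: norm_divide)
      have "F (1 / z) = - ((cpoly p (z + 1 / z))\<^sup>2 * K z / k (1 / z))"
        by (simp add: F_def K_inverse[OF z] add.commute)
      then have "F z + F (1 / z) = - ((cpoly p (z + 1 / z))\<^sup>2 * K z * (k z - k (1 / z)) / (k z * k (1 / z)))"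
        using nz by (simp add: F_def field_simps)
      also have "\<dots> = - of_real (1 - t 1 * t 2) * ((cpoly p (z + 1 / z))\<^sup>2 * ((1 / z - z) * K z) / (k z * k (1 / z)))"
      proof -
        have "- (a * b * (c * d) / x) = - c * (a * (d * b) / x)" for a b c d x :: complex
          by simp
        then show ?thesis
          unfolding k_diff[OF nz(1)] .
      qed
      also have "\<dots> = - of_real (1 - t 1 * t 2) * of_real (\<rho> z)"
        unfolding K_\<omega>[OF z] cpoly_circle[OF z] k_cnj[OF z] \<rho>_def by (simp add: mult.commute flip: complex_norm_square)
      finally show ?thesis .
    qed
    have "E (\<lambda>z. (cpoly p (z + 1 / z))\<^sup>2) = circle_mean (\<lambda>z. - qpoch_inf q q * F z)"
      unfolding E_def
    proof (rule circle_mean_cong)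
      fix z :: complex assume z: "norm z = 1"
      have "w z = - qpoch_inf q q * K z / k z"
        using k_w'[OF z] k_nonzero[OF z] by (simp add: field_simps)
      then show "(cpoly p (z + 1 / z))\<^sup>2 * w z = - qpoch_inf q q * F z"
        by (simp add: F_def)
    qed
    then show "circle_mean F = 0"
      unfolding circle_mean_cmult using assms qq_nonzero by simp
  qed (use z in simp)
  then show "poly p (2 * Re z) = 0"
    using \<omega>_nonzero[OF z] k_nonzero[OF z(1)] by (simp add: \<rho>_def)
qed

text \<open>Now k^2 w is a constant times K k, and symmetrising gives K (k(z) - k(1/z)). The sign is
  opposite to that in \<open>symmetric_norm_nonzero\<close>.\<close>

lemma antisymmetric_norm_nonzero:
  assumes "E (\<lambda>z. (k z * cpoly p (z + 1 / z))\<^sup>2) = 0"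
  shows "p = 0"
proof (rule poly_eq_0_if_zero_on_circle)
  fix z :: complex assume z: "norm z = 1" "Im z \<noteq> 0"
  define \<rho> where "\<rho> z = \<omega> z * (poly p (2 * Re z))\<^sup>2" for z
  define F where "F z = (cpoly p (z + 1 / z))\<^sup>2 * K z * k z" for z
  have "\<rho> z = 0"
  proof (rule circle_mean_symmetric_eq_0[of F \<rho> "complex_of_real (1 - t 1 * t 2)"])
    show "continuous_on (sphere 0 1) F" "continuous_on (sphere 0 1) \<rho>"
      unfolding F_def \<rho>_def by (intro continuous_intros K_continuous k_continuous \<omega>_continuous; auto)+
    show "0 \<le> \<rho> z" for z
      by (simp add: \<rho>_def \<omega>_nonneg)
    show "complex_of_real (1 - t 1 * t 2) \<noteq> 0"
      by (rule one_minus_nonzero)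
    show "F z + F (1 / z) = of_real (1 - t 1 * t 2) * of_real (\<rho> z)" if z: "norm z = 1" for z
    proof -
      have nz: "z \<noteq> 0"
        using z by auto
      have "F (1 / z) = - ((cpoly p (z + 1 / z))\<^sup>2 * K z * k (1 / z))"
        by (simp add: F_def K_inverse[OF z] add.commute)
      then have "F z + F (1 / z) = (cpoly p (z + 1 / z))\<^sup>2 * K z * (k z - k (1 / z))"
        by (simp add: F_def algebra_simps)
      also have "\<dots> = of_real (1 - t 1 * t 2) * ((cpoly p (z + 1 / z))\<^sup>2 * ((1 / z - z) * K z))"
        unfolding k_diff[OF nz] by (simp only: mult_ac)
      also have "\<dots> = of_real (1 - t 1 * t 2) * of_real (\<rho> z)"
        unfolding K_\<omega>[OF z] cpoly_circle[OF z] \<rho>_def by simp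
      finally show ?thesis .
    qed
    have "E (\<lambda>z. (k z * cpoly p (z + 1 / z))\<^sup>2) = circle_mean (\<lambda>z. - qpoch_inf q q * F z)"
      unfolding E_def
    proof (rule circle_mean_cong)
      fix z :: complex assume z: "norm z = 1"
      have "(k z * cpoly p (z + 1 / z))\<^sup>2 * w z = (cpoly p (z + 1 / z))\<^sup>2 * k z * (k z * w z)"
        by (simp add: power2_eq_square)
      then show "(k z * cpoly p (z + 1 / z))\<^sup>2 * w z = - qpoch_inf q q * F z"
        unfolding k_w'[OF z] by (simp add: F_def)
    qed
    then show "circle_mean F = 0"
      unfolding circle_mean_cmult using assms qq_nonzero by simp
  qed (use z in simp)
  then show "poly p (2 * Re z) = 0"
    using \<omega>_nonzero[OF z] by (simp add: \<rho>_def)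
qed

text \<open>The parts u and k v of f are orthogonal by \<open>E_k_symmetric\<close>, so pairing f
  with each part leaves the norm of that part.\<close>

theorem form_nondegenerate:
  assumes f: "f \<in> V n" and orth: "\<And>h. h \<in> V n \<Longrightarrow> E (\<lambda>z. f z * h z) = 0"
  shows "f = 0"
proof -
  obtain p r where pr: "deg_less p (Suc n)" "deg_less r n" "f = laurent 1 p r"
    using V_laurent[of 1 f n] f by auto
  define c where "c = 1 - t 1 * t 2"
  have c: "c \<noteq> 0"
    using one_minus_nonzero unfolding c_def of_real_eq_0_iff .
  \<comment> \<open>From k = lin(X) - c z with X = z + 1/z one gets z = (lin(X) - k)/c; inserting
    this into p + z r yields u and v.\<close>
  define v where "v = smult (- 1 / c) r"
  define lin where "lin = [:- (t 1 + t 2), 1:]"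
  define u where "u = p - lin * v"
  have lin: "deg_less (lin * x) (Suc n)" if "deg_less x n" for x
  proof -
    have "lin * x = smult (- (t 1 + t 2)) x + pCons 0 x"
      by (simp add: lin_def)
    then show ?thesis
      using that by (auto intro!: deg_less_add deg_less_smult deg_less_pCons elim: deg_less_mono)
  qed
  have v: "deg_less v n"
    unfolding v_def using pr by (intro deg_less_smult)
  have u: "deg_less u (Suc n)"
    using deg_less_add[OF pr(1) deg_less_smult[OF lin[OF v], of "-1"]] by (simp add: u_def)
  have kz: "k z = cpoly lin (z + 1 / z) - of_real c * z" if "z \<noteq> 0" for z
    using that by (simp add: k_def lin_def c_def field_simps)
  have f_eq: "f z = cpoly u (z + 1 / z) + k z * cpoly v (z + 1 / z)" if "norm z = 1" for z
  proof -
    define X where "X = z + 1 / z"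
    have z: "z \<noteq> 0"
      using that by (rule norm_1_nonzero)
    have "cpoly lin X - k z = of_real c * z"
      using kz[OF z] by (simp add: X_def)
    then have "z * cpoly r X = (cpoly lin X - k z) / of_real c * cpoly r X"
      using c by simp
    then have "f z = cpoly p X + (cpoly lin X - k z) / of_real c * cpoly r X"
      using z by (simp add: pr(3) laurent_def punctured_def X_def)
    also have "\<dots> = cpoly u X + k z * cpoly v X"
      by (simp add: u_def v_def diff_divide_distrib algebra_simps)
    finally show ?thesis
      by (simp add: X_def)
  qed
  have cont: "continuous_on (sphere 0 1) (\<lambda>z. cpoly x (z + 1 / z))" for x
    by (intro continuous_intros) auto
  have "u = 0"
  proof (rule symmetric_norm_nonzero)
    have "0 = E (\<lambda>z. f z * laurent 1 u 0 z)"
      using orth[of "laurent 1 u 0"] laurent_in_V[of u n 0 1] u by simp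
    also have "\<dots> = E (\<lambda>z. (cpoly u (z + 1 / z))\<^sup>2 + k z * cpoly (u * v) (z + 1 / z))"
      by (rule E_cong) (auto simp: f_eq laurent_def punctured_def power2_eq_square algebra_simps)
    also have "\<dots> = E (\<lambda>z. (cpoly u (z + 1 / z))\<^sup>2)"
      by (subst E_add) (intro continuous_intros cont k_continuous | simp only: E_k_symmetric add_0_right)+
    finally show "E (\<lambda>z. (cpoly u (z + 1 / z))\<^sup>2) = 0" ..
  qed
  moreover have "v = 0"
  proof (rule antisymmetric_norm_nonzero)
    define h where "h = laurent 1 (lin * v) (smult (- c) v)"
    have h: "h z = k z * cpoly v (z + 1 / z)" if "norm z = 1" for z
      using norm_1_nonzero[OF that] by (simp add: h_def laurent_def punctured_def kz algebra_simps)
    have "0 = E (\<lambda>z. f z * h z)"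
      unfolding h_def by (rule orth[OF laurent_in_V[OF lin[OF v] deg_less_smult[OF v]], symmetric])
    also have "\<dots> = E (\<lambda>z. (k z * cpoly v (z + 1 / z))\<^sup>2 + k z * cpoly (u * v) (z + 1 / z))"
      by (rule E_cong) (simp add: f_eq h power2_eq_square algebra_simps)
    also have "\<dots> = E (\<lambda>z. (k z * cpoly v (z + 1 / z))\<^sup>2)"
      by (subst E_add) (intro continuous_intros cont k_continuous | simp only: E_k_symmetric add_0_right)+
    finally show "E (\<lambda>z. (k z * cpoly v (z + 1 / z))\<^sup>2) = 0" ..
  qed
  ultimately have "r = 0" "p = 0"
    using c by (simp_all add: u_def v_def)
  then show ?thesis
    using pr(3) by simp
qed

end

section \<open>Orthogonality\<close>

lemma deg_less_sum: "(\<And>i. i \<in> I \<Longrightarrow> deg_less (f i) n) \<Longrightarrow> deg_less (\<Sum>i\<in>I. f i) n"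
  by (simp add: deg_less_def coeff_sum)

lemma deg_less_expansion:
  assumes "\<And>i. i < n \<Longrightarrow> deg_less (b i) (Suc i) \<and> coeff (b i) i \<noteq> 0" "deg_less p n"
  shows "\<exists>c. p = (\<Sum>i<n. smult (c i) (b i))"
  using assms
proof (induction n arbitrary: p)
  case (Suc n)
  define a where "a = coeff p n / coeff (b n) n"
  have "deg_less (p - smult a (b n)) n"
    unfolding deg_less_def
  proof (intro allI impI)
    fix i assume "n \<le> i"
    then show "coeff (p - smult a (b n)) i = 0"
      using Suc.prems(1)[of n] Suc.prems(2) by (cases "i = n") (auto simp: deg_less_def a_def)
  qed
  then obtain c where c: "p - smult a (b n) = (\<Sum>i<n. smult (c i) (b i))"
    using Suc by (metis less_SucI)
  have "p = (\<Sum>i<Suc n. smult ((c(n := a)) i) (b i))"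
    using c by (simp add: algebra_simps)
  then show ?case
    by blast
qed simp

lemma aw_basis_degree: "deg_less (aw_basis a b q k) (Suc k) \<and> coeff (aw_basis a b q k) k = (\<Prod>i<k. - (a * q ^ i))"
proof (induction k)
  case (Suc k)
  have "aw_basis a b q (Suc k) = smult (1 + b * (q ^ k)\<^sup>2) (aw_basis a b q k) + pCons 0 (smult (- (a * q ^ k)) (aw_basis a b q k))"
    by (simp add: aw_basis_def aw_factor_def mult.commute[of _ "pCons _ _"])
  then show ?case
    using Suc by (auto simp: deg_less_def coeff_pCons split: nat.splits)
qed (simp add: aw_basis_def deg_less_def)

lemma aw_poly_degree: "deg_less (aw_poly a b q d \<alpha> \<beta> \<gamma> n) (Suc n)"
  unfolding aw_poly_def using aw_basis_degree
  by (intro deg_less_sum deg_less_smult) (meson atMost_iff deg_less_mono Suc_le_mono)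

text \<open>Only the summand k = n reaches degree n. The guards \<open>n > 0\<close> cater for T_0,
  whose parameter d = e/q may have absolute value 1 or more.\<close>

lemma aw_poly_lead_coeff:
  assumes q: "0 < q" "q < 1" and "n > 0 \<Longrightarrow> a \<noteq> 0" "n > 0 \<Longrightarrow> \<bar>d\<bar> < 1" "\<bar>\<alpha>\<bar> < 1" "\<bar>\<beta>\<bar> < 1" "\<bar>\<gamma>\<bar> < 1"
  shows "coeff (aw_poly a b q d \<alpha> \<beta> \<gamma> n) n \<noteq> 0"
proof -
  have "coeff (aw_poly a b q d \<alpha> \<beta> \<gamma> n) n =
      (\<Sum>k\<le>n. if k = n then aw_coeff q d \<alpha> \<beta> \<gamma> n n * (\<Prod>i<n. - (a * q ^ i)) else 0)"
    unfolding aw_poly_def coeff_sum using aw_basis_degree[of a b q]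
    by (intro sum.cong) (auto simp: deg_less_def)
  also have "\<dots> = aw_coeff q d \<alpha> \<beta> \<gamma> n n * (\<Prod>i<n. - (a * q ^ i))"
    by simp
  also have "\<dots> \<noteq> 0"
  proof -
    have "(1 / q) ^ n * q ^ i \<noteq> 1" if "i < n" for i
    proof
      assume "(1 / q) ^ n * q ^ i = 1"
      then have "q ^ i = q ^ n"
        using q by (simp add: power_one_over field_simps)
      then show False
        using power_strict_decreasing[of i n q] that q by simp
    qed
    then have "qfac ((1/q)^n) q n \<noteq> 0"
      by (auto simp: qfac_def)
    moreover have "qfac d q n \<noteq> 0"
      using assms qfac_nonzero[of q d n] by (cases n) auto
    ultimately show ?thesis
      using assms qfac_nonzero[of q] by (cases "n = 0") (auto simp: aw_coeff_def)
  qed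
  finally show ?thesis .
qed

text \<open>At a zero of the first factor only the constant basis polynomial survives. This later
  shows that T_m and S_m are nonzero.\<close>

lemma aw_poly_normalized:
  assumes "poly (aw_factor a b q 0) x = 0"
  shows "poly (aw_poly a b q d \<alpha> \<beta> \<gamma> n) x = 1"
proof -
  have "poly (aw_basis a b q k) x = (if k = 0 then 1 else 0)" for k
    using assms by (auto simp: aw_basis_def poly_prod intro!: prod_zero bexI[of _ 0])
  then have "poly (aw_poly a b q d \<alpha> \<beta> \<gamma> n) x = (\<Sum>k\<le>n. if k = 0 then aw_coeff q d \<alpha> \<beta> \<gamma> n 0 else 0)"
    unfolding aw_poly_def poly_sum poly_smult by (intro sum.cong) simp_all
  then show ?thesis
    by (simp add: aw_coeff_def)
qed

lemma aw_poly_qhyper: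
  assumes z: "z \<noteq> 0" and q: "0 < q"
  shows "qhyper [of_real ((1/q)^n), of_real d, of_real a * z, of_real (q * a) / z]
           [of_real \<alpha>, of_real \<beta>, of_real \<gamma>] (of_real q) (of_real q) =
         cpoly (aw_poly a (q * a\<^sup>2) q d \<alpha> \<beta> \<gamma> n) (z + of_real q / z)"
proof -
  define c where "c k = complex_of_real (aw_coeff q d \<alpha> \<beta> \<gamma> n k) * cpoly (aw_basis a (q * a\<^sup>2) q k) (z + of_real q / z)" for k
  have basis: "qpoch (of_real a * z) q k * qpoch (of_real (q * a) / z) q k = cpoly (aw_basis a (q * a\<^sup>2) q k) (z + of_real q / z)" for k
    unfolding qpoch_def aw_basis_def cpoly_prod prod.distrib[symmetric]
  proof (rule prod.cong[OF refl])
    fix i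
    show "(1 - of_real a * z * of_real q ^ i) * (1 - of_real (q * a) / z * of_real q ^ i) = cpoly (aw_factor a (q * a\<^sup>2) q i) (z + of_real q / z)"
      using z by (simp add: aw_factor_def field_simps power2_eq_square)
  qed
  have "qpochs [of_real ((1/q)^n), of_real d, of_real a * z, of_real (q * a) / z] (of_real q) k /
      qpochs [of_real q, of_real \<alpha>, of_real \<beta>, of_real \<gamma>] (of_real q) k * of_real q ^ k = c k" for k
    unfolding qpochs_def c_def basis[symmetric] aw_coeff_def
    by (simp add: qpoch_of_real mult_ac del: of_real_power of_real_divide of_real_mult)
       (simp add: mult_ac)
  then have "qhyper [of_real ((1/q)^n), of_real d, of_real a * z, of_real (q * a) / z]
      [of_real \<alpha>, of_real \<beta>, of_real \<gamma>] (of_real q) (of_real q) = (\<Sum>k. c k)"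
    unfolding qhyper_def by simp
  \<comment> \<open>The factor (q^(-n); q)_k vanishes for k > n, so the series terminates.\<close>
  also have "\<dots> = (\<Sum>k\<le>n. c k)"
    using q by (intro suminf_finite) (auto simp: c_def aw_coeff_def qfac_inverse_power_eq_0)
  also have "\<dots> = cpoly (aw_poly a (q * a\<^sup>2) q d \<alpha> \<beta> \<gamma> n) (z + of_real q / z)"
    by (simp add: c_def aw_poly_def)
  finally show ?thesis .
qed

section \<open>The moment functionals of the two families\<close>

context cherednik
begin

definition T_poly :: "nat \<Rightarrow> real poly" where
  "T_poly m = aw_poly (t 1) (q * (t 1)\<^sup>2) q (e * q powi (int m - 1)) (q * t 1 * t 2) (t 1 * t 3) (t 1 * t 4) m"

text \<open>The index is shifted: \<open>S_poly m\<close> belongs to S_(m+1), so that q^(1-n)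
  becomes q^(-m) and the degree is at most m.\<close>

definition S_poly :: "nat \<Rightarrow> real poly" where
  "S_poly m = aw_poly (t 1) (q * (t 1)\<^sup>2) q (e * q ^ Suc m) (q * t 1 * t 2) (q * t 1 * t 3) (q * t 1 * t 4) m"

lemma T_eq: "T m t q = punctured (\<lambda>z. cpoly (T_poly m) (z + q / z))"
proof
  fix z
  show "T m t q z = punctured (\<lambda>z. cpoly (T_poly m) (z + q / z)) z"
    using q unfolding T_def T_poly_def punctured_def e_def
    by (auto simp: power_int_minus power_one_over inverse_eq_divide simp flip: aw_poly_qhyper)
qed

lemma S_eq: "S (Suc m) t q = punctured (\<lambda>z. g z * cpoly (S_poly m) (z + q / z))"
proof
  fix z
  show "S (Suc m) t q z = punctured (\<lambda>z. g z * cpoly (S_poly m) (z + q / z)) z"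
    using q unfolding S_def S_poly_def punctured_def e_def g_def
    by (auto simp: power_int_minus power_one_over inverse_eq_divide simp flip: aw_poly_qhyper)
qed

lemma cherednik_shift: "cherednik q (t(1 := t 1 * q ^ j))"
proof
  have "\<bar>t 1 * q ^ j\<bar> < 1"
    using q t_bounds(1) mult_right_le_one_le[of "\<bar>t 1\<bar>" "q ^ j"] by (simp add: abs_mult power_le_one)
  then show "\<bar>(t(1 := t 1 * q ^ j)) i\<bar> < 1" if "i \<in> {1..4}" for i
    using t that by auto
qed (use q in auto)

lemma e_bound: "\<bar>e\<bar> < 1"
  unfolding e_def by (intro prod_bound t_bounds)

lemma symmetric_continuous: "continuous_on (sphere 0 1) (\<lambda>z. cpoly p (z + of_real q / z))"
  by (intro continuous_intros) auto

definition L :: "nat \<Rightarrow> real poly \<Rightarrow> complex" where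
  "L j p = cherednik.E q (t(1 := t 1 * q ^ j)) (\<lambda>z. cpoly p (z + q / z))"

text \<open>The S_m share the factor \<open>g\<close>, so their products are integrated against g^2
  w. As \<open>g\<close> does not involve t_1, the shift of t_1 leaves it alone.\<close>

definition M :: "nat \<Rightarrow> real poly \<Rightarrow> complex" where
  "M j p = cherednik.E q (t(1 := t 1 * q ^ j)) (\<lambda>z. (g z)\<^sup>2 * cpoly p (z + q / z))"

lemma E_shift_power:
  "cherednik.E q (t(1 := t 1 * q ^ Suc j)) f =
     cherednik.E q (t(1 := t 1 * q ^ j)) (\<lambda>z. cpoly (aw_factor (t 1) (q * (t 1)\<^sup>2) q j) (z + q / z) * f z)"
proof -
  interpret s: cherednik q "t(1 := t 1 * q ^ j)"
    by (rule cherednik_shift)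
  have "t(1 := t 1 * q ^ Suc j) = (t(1 := t 1 * q ^ j))(1 := q * (t(1 := t 1 * q ^ j)) 1)"
    by (simp add: fun_eq_iff)
  then have "cherednik.E q (t(1 := t 1 * q ^ Suc j)) f =
      s.E (\<lambda>z. (1 - (t(1 := t 1 * q ^ j)) 1 * z) * (1 - q * (t(1 := t 1 * q ^ j)) 1 / z) * f z)"
    by (simp only: s.E_shift)
  also have "\<dots> = s.E (\<lambda>z. cpoly (aw_factor (t 1) (q * (t 1)\<^sup>2) q j) (z + q / z) * f z)"
    by (rule s.E_cong, drule norm_1_nonzero) (simp add: aw_factor_def field_simps power2_eq_square)
  finally show ?thesis .
qed

lemma g_continuous: "continuous_on (sphere 0 1) g"
  unfolding g_def[abs_def] by (intro continuous_intros) auto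

lemma mass_shift_power:
  "L (Suc j) 1 * of_real (1 - e * q ^ j) =
     L j 1 * of_real ((1 - q * t 1 * t 2 * q ^ j) * (1 - t 1 * t 3 * q ^ j) * (1 - t 1 * t 4 * q ^ j))"
proof -
  interpret s: cherednik q "t(1 := t 1 * q ^ j)"
    by (rule cherednik_shift)
  have "t(1 := t 1 * q ^ Suc j) = (t(1 := t 1 * q ^ j))(1 := q * (t(1 := t 1 * q ^ j)) 1)"
    by (simp add: fun_eq_iff)
  then show ?thesis
    using s.mass_shift unfolding L_def s.e_def e_def by (simp add: mult_ac)
qed

text \<open>In Askey-Wilson notation the parameters are q^(1/2) t_1, q^(1/2) t_2, q^(-1/2) t_3,
  q^(-1/2) t_4. For \<open>M\<close> below, t_3 and t_4 are multiplied by q, which makes their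
  product q^2 e.\<close>

lemma aw_moments_L:
  assumes "t 1 \<noteq> 0"
  shows "aw_moments L (t 1) (q * (t 1)\<^sup>2) q e (q * t 1 * t 2) (t 1 * t 3) (t 1 * t 4)"
proof
  fix j p r c
  interpret s: cherednik q "t(1 := t 1 * q ^ j)"
    by (rule cherednik_shift)
  show "L j (p + r) = L j p + L j r"
    unfolding L_def cpoly_add by (intro s.E_add symmetric_continuous)
  show "L j (smult c p) = of_real c * L j p"
    unfolding L_def cpoly_smult by (rule s.E_cmult)
  show "L (Suc j) p = L j (aw_factor (t 1) (q * (t 1)\<^sup>2) q j * p)"
    unfolding L_def E_shift_power by simp
qed (use mass_shift_power assms q e_bound t_bounds prod_bound q_bound in \<open>auto simp: e_def power2_eq_square\<close>)

text \<open>\<open>g_square_mean\<close> ties the mean of g^2 to the total mass at j and at j + 1,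
  and \<open>mass_shift_power\<close> relates these two masses.\<close>

lemma g_square_mass_shift:
  "M (Suc j) 1 * of_real (1 - q\<^sup>2 * e * q ^ j) =
     M j 1 * of_real ((1 - q * t 1 * t 2 * q ^ j) * (1 - q * t 1 * t 3 * q ^ j) * (1 - q * t 1 * t 4 * q ^ j))"
proof -
  \<comment> \<open>The part independent of j. It is zero for t_3 t_4 = q, so it is carried along
    and never divided by.\<close>
  define C where "C = complex_of_real ((t 3 * t 4 - q) * (1 - t 3 * t 4) * (1 - t 2 * t 3) * (1 - t 2 * t 4))"
  have M: "M j 1 * of_real ((1 - e * q ^ j) * (1 - q * e * q ^ j)) =
      C * of_real ((1 - t 1 * t 3 * q ^ j) * (1 - t 1 * t 4 * q ^ j)) * L j 1" for j
  proof -
    interpret s: cherednik q "t(1 := t 1 * q ^ j)"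
      by (rule cherednik_shift)
    have "s.g = g"
      by (rule ext) (simp only: s.g_def g_def, simp)
    then show ?thesis
      using s.g_square_mean unfolding M_def L_def s.e_def e_def C_def by (simp add: mult_ac)
  qed
  have nz: "complex_of_real (1 - e * x) \<noteq> 0" if "\<bar>x\<bar> \<le> 1" for x
  proof -
    have "\<bar>e * x\<bar> < 1"
      using e_bound that mult_right_le_one_le[of "\<bar>e\<bar>" "\<bar>x\<bar>"] by (simp add: abs_mult)
    then show ?thesis
      by (simp only: of_real_eq_0_iff)
  qed
  have qj: "\<bar>q ^ i\<bar> \<le> 1" for i
    using q by (simp add: power_le_one)
  define x0 x1 x2 where "x0 = complex_of_real (1 - e * q ^ j)" and "x1 = complex_of_real (1 - e * q ^ Suc j)"
    and "x2 = complex_of_real (1 - e * q ^ Suc (Suc j))"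
  define a where "a = complex_of_real ((1 - t 1 * t 3 * q ^ j) * (1 - t 1 * t 4 * q ^ j))"
  define b where "b = complex_of_real ((1 - q * t 1 * t 3 * q ^ j) * (1 - q * t 1 * t 4 * q ^ j))"
  define d where "d = complex_of_real (1 - q * t 1 * t 2 * q ^ j)"
  have x: "x0 \<noteq> 0" "x1 \<noteq> 0"
    unfolding x0_def x1_def using nz qj by blast+
  have 1: "M (Suc j) 1 * (x1 * x2) = C * b * L (Suc j) 1"
    using M[of "Suc j"] by (simp add: x1_def x2_def b_def mult_ac)
  have 2: "M j 1 * (x0 * x1) = C * a * L j 1"
    using M[of j] by (simp add: x0_def x1_def a_def mult_ac)
  have 3: "L (Suc j) 1 * x0 = L j 1 * (d * a)"
    using mass_shift_power[of j] by (simp add: x0_def d_def a_def mult_ac)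
  have "(M (Suc j) 1 * x2) * (x0 * x1) = (M (Suc j) 1 * (x1 * x2)) * x0"
    by simp
  also have "\<dots> = C * b * (L (Suc j) 1 * x0)"
    unfolding 1 by simp
  also have "\<dots> = (M j 1 * (d * b)) * (x0 * x1)"
    using 2 unfolding 3 by (simp add: mult_ac)
  finally have "M (Suc j) 1 * x2 = M j 1 * (d * b)"
    using x by simp
  then show ?thesis
    by (simp add: x2_def d_def b_def power2_eq_square mult_ac)
qed

lemma aw_moments_M:
  assumes "t 1 \<noteq> 0"
  shows "aw_moments M (t 1) (q * (t 1)\<^sup>2) q (q\<^sup>2 * e) (q * t 1 * t 2) (q * t 1 * t 3) (q * t 1 * t 4)"
proof
  fix j p r c
  interpret s: cherednik q "t(1 := t 1 * q ^ j)"
    by (rule cherednik_shift)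
  show "M j (p + r) = M j p + M j r"
    unfolding M_def cpoly_add ring_distribs
    by (intro s.E_add continuous_intros symmetric_continuous g_continuous)
  have "s.E (\<lambda>z. of_real c * ((g z)\<^sup>2 * cpoly p (z + q / z))) = of_real c * M j p"
    unfolding M_def by (rule s.E_cmult)
  then show "M j (smult c p) = of_real c * M j p"
    unfolding M_def cpoly_smult by (simp add: mult_ac)
  show "M (Suc j) p = M j (aw_factor (t 1) (q * (t 1)\<^sup>2) q j * p)"
    unfolding M_def E_shift_power by (simp add: mult_ac)
  show "M (Suc j) 1 * of_real (1 - q\<^sup>2 * e * q ^ j) =
     M j 1 * of_real ((1 - q * t 1 * t 2 * q ^ j) * (1 - q * t 1 * t 3 * q ^ j) * (1 - q * t 1 * t 4 * q ^ j))"
    by (rule g_square_mass_shift)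
  have "\<bar>q\<^sup>2\<bar> < 1"
    using q by (simp add: power_less_one_iff)
  then show "\<bar>q\<^sup>2 * e\<bar> < 1"
    by (intro prod_bound e_bound)
qed (use assms q t_bounds prod_bound q_bound in \<open>auto simp: e_def power2_eq_square\<close>)

lemma T_T_orthogonal:
  assumes "i < m" "t 1 \<noteq> 0"
  shows "E (\<lambda>z. T m t q z * T i t q z) = 0"
proof -
  interpret aw_moments L "t 1" "q * (t 1)\<^sup>2" q e "q * t 1 * t 2" "t 1 * t 3" "t 1 * t 4"
    by (rule aw_moments_L) fact
  have "e * q powi (int m - 1) * q = e * q ^ m"
    using q(1) by (simp add: power_int_diff)
  moreover have "degree (T_poly i) < m"
    using aw_poly_degree assms unfolding T_poly_def deg_less_Suc_iff by (metis le_less_trans)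
  ultimately have "L 0 (T_poly m * T_poly i) = 0"
    unfolding T_poly_def[of m] by (rule aw_poly_orthogonal)
  moreover have "E (\<lambda>z. T m t q z * T i t q z) = E (\<lambda>z. cpoly (T_poly m * T_poly i) (z + q / z))"
    by (rule E_cong, drule norm_1_nonzero) (simp add: T_eq punctured_def)
  ultimately show ?thesis
    by (simp add: L_def)
qed

lemma S_S_orthogonal:
  assumes "i < m" "t 1 \<noteq> 0"
  shows "E (\<lambda>z. S (Suc m) t q z * S (Suc i) t q z) = 0"
proof -
  interpret aw_moments M "t 1" "q * (t 1)\<^sup>2" q "q\<^sup>2 * e" "q * t 1 * t 2" "q * t 1 * t 3" "q * t 1 * t 4"
    by (rule aw_moments_M) fact
  have "e * q ^ Suc m * q = q\<^sup>2 * e * q ^ m"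
    by (simp add: power2_eq_square)
  moreover have "degree (S_poly i) < m"
    using aw_poly_degree assms unfolding S_poly_def deg_less_Suc_iff by (metis le_less_trans)
  ultimately have "M 0 (S_poly m * S_poly i) = 0"
    unfolding S_poly_def[of m] by (rule aw_poly_orthogonal)
  moreover have "E (\<lambda>z. S (Suc m) t q z * S (Suc i) t q z) = E (\<lambda>z. (g z)\<^sup>2 * cpoly (S_poly m * S_poly i) (z + q / z))"
    by (rule E_cong, drule norm_1_nonzero) (simp add: S_eq punctured_def power2_eq_square)
  ultimately show ?thesis
    by (simp add: M_def)
qed

lemma T_S_orthogonal: "E (\<lambda>z. T m t q z * S (Suc i) t q z) = 0"
proof -
  have "E (\<lambda>z. T m t q z * S (Suc i) t q z) = E (\<lambda>z. g z * cpoly (T_poly m * S_poly i) (z + q / z))"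
    by (rule E_cong, drule norm_1_nonzero) (simp add: T_eq S_eq punctured_def)
  then show ?thesis
    by (simp only: E_g_symmetric)
qed

section \<open>The basis\<close>

lemma T_in_V: "T m t q \<in> V m"
proof -
  have "T m t q = laurent q (T_poly m) 0"
    by (simp add: T_eq laurent_def)
  then show ?thesis
    using laurent_in_V[of "T_poly m" m 0 q] by (simp add: T_poly_def aw_poly_degree)
qed

text \<open>The coefficient of z vanishes exactly when t_3 t_4 = q; otherwise z can be recovered
  from \<open>g\<close> and z + q/z.\<close>

lemma g_laurent:
  fixes z :: complex
  assumes "z \<noteq> 0"
  shows "g z = of_real (1 - t 3 * t 4 / q) * z + cpoly [:- (t 3 + t 4), t 3 * t 4 / q:] (z + q / z)"
  using assms q by (simp add: g_def field_simps)

lemma S_in_V: "S (Suc m) t q \<in> V (Suc m)"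
proof -
  define lin where "lin = [:- (t 3 + t 4), t 3 * t 4 / q:]"
  define p where "p = lin * S_poly m"
  define r where "r = smult (1 - t 3 * t 4 / q) (S_poly m)"
  have S: "deg_less (S_poly m) (Suc m)"
    by (simp add: S_poly_def aw_poly_degree)
  have "S (Suc m) t q = laurent q p r"
  proof
    fix z :: complex
    have "g z * cpoly (S_poly m) (z + q / z) = cpoly p (z + q / z) + z * cpoly r (z + q / z)" if "z \<noteq> 0"
      unfolding g_laurent[OF that] lin_def[symmetric] p_def r_def cpoly_mult cpoly_smult by (simp only: ring_distribs mult_ac add_ac)
    then show "S (Suc m) t q z = laurent q p r z"
      by (simp add: S_eq laurent_def punctured_def)
  qed
  moreover have "p = smult (- (t 3 + t 4)) (S_poly m) + pCons 0 (smult (t 3 * t 4 / q) (S_poly m))"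
    by (simp add: p_def lin_def)
  then have "deg_less p (Suc (Suc m))"
    using S by (auto intro!: deg_less_add deg_less_smult deg_less_pCons elim: deg_less_mono)
  moreover have "deg_less r (Suc m)"
    using S by (simp add: r_def deg_less_smult)
  ultimately show ?thesis
    using laurent_in_V by simp
qed

lemma V_mono: "m \<le> n \<Longrightarrow> V m \<subseteq> V n"
  unfolding V_altdef by (intro span_mono image_mono) auto

lemma sum_fun: "(\<Sum>i\<in>I. f i) z = (\<Sum>i\<in>I. f i z)"
  by (induction I rule: infinite_finite_induct) simp_all

text \<open>Used with h = 1 for the T family and with h = g for the S family.\<close>

lemma punctured_expansion_in_span:
  assumes "p = (\<Sum>i<n. smult (c i) (b i))"
    and "\<And>i. i < n \<Longrightarrow> punctured (\<lambda>z. h z * cpoly (b i) (z + q / z)) \<in> B"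
  shows "punctured (\<lambda>z. h z * cpoly p (z + q / z)) \<in> span B"
proof -
  have "punctured (\<lambda>z. h z * cpoly p (z + q / z)) = (\<Sum>i<n. c i *\<^sub>R punctured (\<lambda>z. h z * cpoly (b i) (z + q / z)))"
    by (auto simp: fun_eq_iff sum_fun scaleR_fun_def punctured_def assms(1) sum_distrib_left scaleR_conv_of_real mult_ac)
  also have "\<dots> \<in> span B"
    using assms(2) by (intro span_sum span_scale span_base) auto
  finally show ?thesis .
qed

text \<open>Trading z for g in p + z r writes f as p'(X) + g r'(X) with X = z + q/z.
  \<open>T_poly i\<close> and \<open>S_poly i\<close> have exact degree i, so p' and r' expand in
  them.\<close>

lemma V_subset_span:
  assumes "n \<ge> 1 \<Longrightarrow> t 1 \<noteq> 0" "n \<ge> 1 \<Longrightarrow> t 3 * t 4 \<noteq> q"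
  shows "V n \<subseteq> span ((\<lambda>m. T m t q) ` {0..n} \<union> (\<lambda>m. S m t q) ` {1..n})" (is "_ \<subseteq> span ?B")
proof
  fix f assume "f \<in> V n"
  then obtain p r where pr: "deg_less p (Suc n)" "deg_less r n" "f = laurent q p r"
    using V_laurent[of q f n] q by auto
  define c where "c = 1 - t 3 * t 4 / q"
  define lin where "lin = [:- (t 3 + t 4), t 3 * t 4 / q:]"
  define r' where "r' = smult (1 / c) r"
  define p' where "p' = p - lin * r'"
  have r': "deg_less r' n"
    using pr by (simp add: r'_def deg_less_smult)
  have p'_eq: "p' = p + (smult (t 3 + t 4) r' + pCons 0 (smult (- (t 3 * t 4 / q)) r'))"
    by (simp add: p'_def lin_def smult_add_left smult_diff_left)
  have "deg_less r' (Suc n)"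
    using r' by (rule deg_less_mono) simp
  then have p': "deg_less p' (Suc n)"
    unfolding p'_eq using pr(1) r' by (intro deg_less_add deg_less_smult deg_less_pCons)
  have f_eq: "f = punctured (\<lambda>z. 1 * cpoly p' (z + q / z)) + punctured (\<lambda>z. g z * cpoly r' (z + q / z))"
  proof
    fix z
    show "f z = (punctured (\<lambda>z. 1 * cpoly p' (z + q / z)) + punctured (\<lambda>z. g z * cpoly r' (z + q / z))) z"
    \<comment> \<open>For n = 0 the constant c may be zero, but then r = 0 and there is nothing to
      divide.\<close>
    proof (cases "z = 0 \<or> n = 0")
      case True
      then show ?thesis
        using pr r' by (auto simp: pr(3) laurent_def punctured_def p'_def)
    next
      case False
      define X where "X = z + q / z"
      have c: "c \<noteq> 0"
        using assms(2) False q by (auto simp: c_def field_simps)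
      have g: "g z = of_real c * z + cpoly lin X"
        using g_laurent[of z] False by (simp add: c_def lin_def X_def)
      have "cpoly p' X + g z * cpoly r' X = cpoly p X + z * (of_real c * cpoly r' X)"
        by (simp add: p'_def g algebra_simps)
      also have "of_real c * cpoly r' X = cpoly r X"
        using c by (simp add: r'_def)
      finally show ?thesis
        using False by (simp add: pr(3) laurent_def punctured_def X_def)
    qed
  qed
  have e_small: "\<bar>e * q ^ i\<bar> < 1" for i
    using q e_bound mult_right_le_one_le[of "\<bar>e\<bar>" "q ^ i"] by (simp add: abs_mult power_le_one)
  have bounds: "\<bar>q * t 1 * t 2\<bar> < 1" "\<bar>t 1 * t 3\<bar> < 1" "\<bar>t 1 * t 4\<bar> < 1" "\<bar>q * t 1 * t 3\<bar> < 1" "\<bar>q * t 1 * t 4\<bar> < 1"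
    by (intro prod_bound q_bound t_bounds)+
  have T: "deg_less (T_poly i) (Suc i) \<and> coeff (T_poly i) i \<noteq> 0" if "i < Suc n" for i
  proof (intro conjI)
    show "deg_less (T_poly i) (Suc i)"
      by (simp add: T_poly_def aw_poly_degree)
    have "\<bar>e * q powi (int i - 1)\<bar> < 1" if i: "i > 0"
    proof -
      obtain j where "i = Suc j"
        using i by (cases i) auto
      then show ?thesis
        using e_small[of j] by simp
    qed
    then show "coeff (T_poly i) i \<noteq> 0"
      unfolding T_poly_def using that assms(1) q bounds by (intro aw_poly_lead_coeff) auto
  qed
  have S: "deg_less (S_poly i) (Suc i) \<and> coeff (S_poly i) i \<noteq> 0" if "i < n" for i
  proof (intro conjI)
    show "deg_less (S_poly i) (Suc i)"
      by (simp add: S_poly_def aw_poly_degree)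
    show "coeff (S_poly i) i \<noteq> 0"
      unfolding S_poly_def using that assms(1) q bounds e_small[of "Suc i"] by (intro aw_poly_lead_coeff) auto
  qed
  obtain a b where ab: "p' = (\<Sum>i<Suc n. smult (a i) (T_poly i))" "r' = (\<Sum>i<n. smult (b i) (S_poly i))"
    using deg_less_expansion[OF T p'] deg_less_expansion[OF S r'] by blast
  have "punctured (\<lambda>z. 1 * cpoly p' (z + q / z)) \<in> span ?B"
    by (rule punctured_expansion_in_span[OF ab(1)]) (auto simp: T_eq[symmetric])
  moreover have "punctured (\<lambda>z. g z * cpoly r' (z + q / z)) \<in> span ?B"
    by (rule punctured_expansion_in_span[OF ab(2)]) (auto simp: S_eq[symmetric])
  ultimately show "f \<in> span ?B"
    unfolding f_eq by (rule span_add)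
qed

lemma T_nonzero:
  assumes "m \<ge> 1 \<Longrightarrow> t 1 \<noteq> 0"
  shows "T m t q \<noteq> 0"
proof (cases "m = 0")
  case True
  then have "T m t q 1 = 1"
    by (simp add: T_eq punctured_def T_poly_def aw_poly_def aw_coeff_def aw_basis_def)
  then show ?thesis
    by auto
next
  case False
  then have t1: "t 1 \<noteq> 0"
    using assms by simp
  \<comment> \<open>The value of z + q/z at z = 1/t_1, where 1 - t_1 z vanishes.\<close>
  define x where "x = 1 / t 1 + q * t 1"
  have "poly (T_poly m) x = 1"
    unfolding T_poly_def using t1
    by (intro aw_poly_normalized) (simp add: aw_factor_def x_def field_simps power2_eq_square)
  then have "T m t q (of_real (1 / t 1)) = 1"
    using t1 cpoly_of_real[of "T_poly m" x] by (simp add: T_eq punctured_def x_def)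
  then show ?thesis
    by auto
qed

text \<open>At z = 1/t_1 the polynomial factor is 1, and \<open>g\<close> is nonzero because |t_1
  t_3| and |t_1 t_4| are below 1.\<close>

lemma S_nonzero:
  assumes t1: "t 1 \<noteq> 0"
  shows "S (Suc m) t q \<noteq> 0"
proof -
  define x where "x = 1 / t 1 + q * t 1"
  have "poly (S_poly m) x = 1"
    unfolding S_poly_def using t1
    by (intro aw_poly_normalized) (simp add: aw_factor_def x_def field_simps power2_eq_square)
  then have "S (Suc m) t q (of_real (1 / t 1)) = of_real ((1 - t 3 * t 1) * (1 - t 4 * t 1) / t 1)"
    using t1 cpoly_of_real[of "S_poly m" x] by (simp add: S_eq punctured_def x_def g_def)
  moreover have "t 3 * t 1 \<noteq> 1" "t 4 * t 1 \<noteq> 1"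
    using prod_bound[OF t_bounds(3,1)] prod_bound[OF t_bounds(4,1)] by auto
  ultimately show ?thesis
    using t1 by (auto simp del: of_real_mult of_real_divide)
qed

lemma orthogonal_to_span:
  assumes f: "f \<in> V n" and B: "B \<subseteq> V n" "\<And>b. b \<in> B \<Longrightarrow> E (\<lambda>z. f z * b z) = 0" and h: "h \<in> span B"
  shows "E (\<lambda>z. f z * h z) = 0"
proof -
  have "h \<in> V n \<and> E (\<lambda>z. f z * h z) = 0"
    using h
  proof (induction rule: span_induct_alt)
    case base
    have "(0 :: complex \<Rightarrow> complex) \<in> V n"
      by (simp only: V_altdef span_zero)
    moreover have "E (\<lambda>z. f z * 0 z) = 0"
      using E_cmult[of 0 f] by simp
    ultimately show ?case ..
  next
    case (step c x y)
    then have xy: "x \<in> V n" "y \<in> V n"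
      using B by auto
    have "E (\<lambda>z. f z * (c *\<^sub>R x + y) z) = E (\<lambda>z. of_real c * (f z * x z) + f z * y z)"
      by (intro E_cong) (simp add: scaleR_fun_def scaleR_conv_of_real algebra_simps)
    also have "\<dots> = of_real c * E (\<lambda>z. f z * x z) + E (\<lambda>z. f z * y z)"
      using V_continuous[OF f] xy[THEN V_continuous] by (subst E_add) (intro continuous_intros | simp only: E_cmult)+
    finally have "E (\<lambda>z. f z * (c *\<^sub>R x + y) z) = 0"
      using step B by simp
    then show ?case
      using xy V_add V_scale by blast
  qed
  then show ?thesis ..
qed

end

text \<open>A member of zero norm would be orthogonal to B, hence to \<open>V n\<close>, against
  \<open>form_nondegenerate\<close>. With nonzero norms, no member lies in the span of the others,
  since it would be orthogonal to itself.\<close>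

theorem orthogonal_basisI:
  fixes B :: "(complex \<Rightarrow> complex) set"
  assumes "cherednik q t" and B: "B \<subseteq> V n" "V n \<subseteq> span B" "0 \<notin> B"
    and orth: "pairwise (\<lambda>f g. form_cher t q f g = 0) B"
  shows "orthogonal_basis (form_cher t q) (V n) B \<and> (\<forall>b\<in>B. form_cher t q b b \<noteq> 0)"
proof -
  interpret cherednik q t by fact
  have span: "span B = V n"
    using B(1,2) unfolding V_altdef by (metis span_mono span_span subset_antisym)
  have orth': "E (\<lambda>z. b z * b' z) = 0" if "b \<in> B" "b' \<in> B" "b \<noteq> b'" for b b'
    using orth that by (auto simp: pairwise_def form_eq_E)
  have norm: "E (\<lambda>z. b z * b z) \<noteq> 0" if b: "b \<in> B" for b
  proof
    assume "E (\<lambda>z. b z * b z) = 0"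
    then have "E (\<lambda>z. b z * b' z) = 0" if "b' \<in> B" for b'
      using orth' b that by (cases "b = b'") auto
    then have "E (\<lambda>z. b z * h z) = 0" if "h \<in> V n" for h
      using orthogonal_to_span[of b n B h] B b that span by auto
    then have "b = 0"
      using form_nondegenerate[of b n] B b by auto
    then show False
      using B(3) b by simp
  qed
  have "independent B"
    unfolding dependent_def
  proof safe
    fix b assume b: "b \<in> B" "b \<in> span (B - {b})"
    have "E (\<lambda>z. b z * b z) = 0"
      using b B(1) orth' by (intro orthogonal_to_span[of b n "B - {b}" b]) auto
    then show False
      using norm b by simp
  qed
  then show ?thesis
    using span orth norm by (simp add: orthogonal_basis_def form_eq_E)
qed

text \<open>For n \<ge> 1 two degenerate cases are excluded: if t_1 = 0, each T_m with m \<ge> 1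
  collapses to a vanishing q-binomial sum; if t_3 t_4 = q, all members depend on z + q/z only and
  cannot span \<open>V n\<close>.\<close>

theorem theorem4p1:
  fixes q :: real and t :: "nat \<Rightarrow> real" and n :: nat
  assumes q: "0 < q" "q < 1"
    and t: "\<And>i. i \<in> {1..4} \<Longrightarrow> \<bar>t i\<bar> < 1"
    and nondegenerate: "n \<ge> 1 \<Longrightarrow> t 1 \<noteq> 0" "n \<ge> 1 \<Longrightarrow> t 3 * t 4 \<noteq> q"
  shows "orthogonal_basis (form_cher t q) (V n)
           ((\<lambda>m. T m t q) ` {0..n} \<union> (\<lambda>m. S m t q) ` {1..n}) \<and>
         (\<forall>m\<in>{0..n}. form_cher t q (T m t q) (T m t q) \<noteq> 0) \<and>
         (\<forall>m\<in>{1..n}. form_cher t q (S m t q) (S m t q) \<noteq> 0)"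
proof -
  interpret cherednik q t
    using q t by unfold_locales
  let ?B = "(\<lambda>m. T m t q) ` {0..n} \<union> (\<lambda>m. S m t q) ` {1..n}"
  have S: "\<exists>i. m = Suc i \<and> i < n \<and> t 1 \<noteq> 0" if "m \<in> {1..n}" for m
    using that nondegenerate(1) by (cases m) auto
  have comm: "form_cher t q f h = form_cher t q h f" for f h
    by (simp add: form_eq_E mult.commute)
  have TT: "form_cher t q (T m t q) (T i t q) = 0" if "m \<in> {0..n}" "i \<in> {0..n}" "m \<noteq> i" for m i
    using that nondegenerate(1) T_T_orthogonal[of i m] T_T_orthogonal[of m i] comm[of "T m t q" "T i t q"]
    unfolding form_eq_E by (cases "i < m") auto
  have SS: "form_cher t q (S m t q) (S i t q) = 0" if mi: "m \<in> {1..n}" "i \<in> {1..n}" "m \<noteq> i" for m i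
  proof -
    obtain m' i' where "m = Suc m'" "i = Suc i'" "t 1 \<noteq> 0"
      using S mi by blast
    then show ?thesis
      using mi(3) S_S_orthogonal[of i' m'] S_S_orthogonal[of m' i'] comm[of "S m t q" "S i t q"]
      unfolding form_eq_E by (cases "i' < m'") auto
  qed
  have TS: "form_cher t q (T m t q) (S i t q) = 0" if "i \<in> {1..n}" for m i
    using S[OF that] T_S_orthogonal by (auto simp: form_eq_E)
  have "pairwise (\<lambda>f g. form_cher t q f g = 0) ?B"
  proof (rule pairwiseI)
    fix f h assume "f \<in> ?B" "h \<in> ?B" "f \<noteq> h"
    then consider m i where "f = T m t q" "h = T i t q" "m \<in> {0..n}" "i \<in> {0..n}" "m \<noteq> i"
      | m i where "f = S m t q" "h = S i t q" "m \<in> {1..n}" "i \<in> {1..n}" "m \<noteq> i"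
      | m i where "f = T m t q" "h = S i t q" "i \<in> {1..n}"
      | m i where "f = S i t q" "h = T m t q" "i \<in> {1..n}"
      by blast
    then show "form_cher t q f h = 0"
    proof cases
      case 1 then show ?thesis by (simp only: TT not_False_eq_True)
    next
      case 2 then show ?thesis by (simp only: SS not_False_eq_True)
    next
      case 3 then show ?thesis by (simp only: TS)
    next
      case 4 then show ?thesis using comm[of f h] by (simp only: TS)
    qed
  qed
  moreover have "?B \<subseteq> V n"
  proof
    fix b assume "b \<in> ?B"
    then show "b \<in> V n"
    proof
      assume "b \<in> (\<lambda>m. T m t q) ` {0..n}"
      then obtain m where "b = T m t q" "m \<le> n"
        by auto
      then show ?thesis
        using T_in_V V_mono by blast
    next
      assume "b \<in> (\<lambda>m. S m t q) ` {1..n}"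
      then obtain i where "b = S (Suc i) t q" "Suc i \<le> n"
        using S by fastforce
      then show ?thesis
        using S_in_V V_mono by blast
    qed
  qed
  moreover have "b \<noteq> 0" if "b \<in> ?B" for b
    using that
  proof
    assume "b \<in> (\<lambda>m. T m t q) ` {0..n}"
    then obtain m where "b = T m t q" "m \<le> n"
      by auto
    then show ?thesis
      using T_nonzero[of m] nondegenerate(1) by simp
  next
    assume "b \<in> (\<lambda>m. S m t q) ` {1..n}"
    then obtain i where "b = S (Suc i) t q" "t 1 \<noteq> 0"
      using S by blast
    then show ?thesis
      using S_nonzero by simp
  qed
  ultimately have "orthogonal_basis (form_cher t q) (V n) ?B \<and> (\<forall>b\<in>?B. form_cher t q b b \<noteq> 0)"
    using V_subset_span nondegenerate by (intro orthogonal_basisI cherednik_axioms) blast+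
  then show ?thesis
    by blast
qed

end
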